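(* Let $k\ge 1$ and let $G,H$ be simple undirected graphs with vertex set $V=\{1,\dots,n\}$. Then: (i) $\mathcal{T}^k_G=\{\mathcal I_n\}$ (where $\mathcal I_n$ is the $n\times n$ identity matrix) if and only if the $k$-dimensional C-V-C algorithm determines that $G$ is asymmetric; (ii) $\mathcal{T}^k_{G,H}=\emptyset$ if and only if the $k$-dimensional C-V-C algorithm determines that $G$ and $H$ are not isomorphic.
   Context: **Graphs and polytopes.** For a graph $G$ on $V$, $E_G$ is its edge set, $A_G$ its adjacency matrix, $\delta_G(a)=\{b:\{a,b\}\in E_G\}$. Let $e$ be the all-ones vector and $$\mathcal T_{G,H}=\{X\in[0,1]^{n\times n}: A_GX=XA_H,\ Xe=X^Te=e\},\qquad \mathcal T_G=\mathcal T_{G,G}.$$ The equation $A_GX=XA_H$ reads $\sum_{w\in\delta_H(v)}X_{uw}-\sum_{w\in\delta_G(u)}X_{wv}=0$ for all $u,v\in V$. **Sherali-Adams relaxations.** For $P=\{x\in[0,1]^N: f_j(x)=0\ (1\le j\le s),\ g_j(x)\ge 0\ (1\le j\le t)\}$ with polynomials $f_j,g_j$, the $k$th Sherali-Adams relaxation $P^k$ is obtained as follows. Form the constraints $\prod_{i\in I}x_i\, f_j(x)=0$ for all $I\subseteq\{1,\dots,N\}$, $|I|\le k-1$ and all $j$; $\prod_{i\in I}x_i\prod_{i\in J\setminus I}(1-x_i)\,g_j(x)\ge0$ for all $I\subseteq J$, $|J|\le k-1$ and all $j$; and $\prod_{i\in I}x_i\prod_{i\in J\setminus I}(1-x_i)\ge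 0$ for all $I\subseteq J$, $|J|\le k$. Expand, replace every $x_i^2$ by $x_i$ repeatedly until all monomials are square-free, and replace each monomial $\prod_{i\in I}x_i$ with $|I|\ge 1$ by a new variable $y_I$ (and the empty monomial by $1$). This gives a polyhedron $\hat P^k$ in $y$-space, and $P^k=\{x: x_i=y_{\{i\}}\ \forall i,\ y\in\hat P^k\}$. $\mathcal T^k_{G,H}$ and $\mathcal T^k_G$ are the $k$th relaxations of $\mathcal T_{G,H}$ and $\mathcal T_G$, where the $f_j$ are the row-sum equations, the column-sum equations and the entries of $A_GX-XA_H$, and there are no $g_j$. **Tuples.** For $u\in V^k$, $w\in V$, $1\le i\le k$, $\phi_i(u,w)$ is $u$ with its $i$th entry replaced by $w$. Put $\delta_G^i(u)=\{\phi_i(u,w):w\in\delta_G(u_i)\}$ and $\bar\delta_G^i(u)=\{\phi_i(u,w):w\in V\setminus\delta_G(u_i)\}$. For a permutation $\sigma\in S_k$, $\sigma(u)_i=u_{\sigma(i)}$; fix two permutations $\sigma_1,\sigma_2$ generating the symmetric group $S_k$. Let $\vec{\mathcal C}_G(u)$ be the $k\times k$ matrix with $(i,j)$ entry $0$ if $u_i=u_j$, $1$ if $\{u_i,u_j\}\in E_G$, and $-1$ otherwise. **$k$-dim C-V-C algorithm, automorphism version.** For a partition $\pi$ of $V^k$ let $\delta_G(\pi)$ be the partition of $V^k$ in which $u,v$ are equivalent iff: $u\equiv_\pi v$; $\sigma_l(u)\equiv_\pi\sigma_l(v)$ for $l=1,2$; $\vec{\mathcal C}_G(u)=\vec{\mathcal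 C}_G(v)$; and $|\delta_G^i(u)\cap C|=|\delta_G^i(v)\cap C|$, $|\bar\delta_G^i(u)\cap C|=|\bar\delta_G^i(v)\cap C|$ for all cells $C$ of $\pi$ and $1\le i\le k$. Starting from the trivial partition $\{V^k\}$, iterate $\pi\mapsto\delta_G(\pi)$ until it stabilises. The algorithm determines that $G$ is asymmetric iff the resulting stable partition is complete, i.e. all its cells are singletons. **Isomorphism version.** For an ordered partition $\vec\pi=(\vec\pi_1,\dots,\vec\pi_m)$ of $V^k$ write $[u]_{\vec\pi}=i$ if $u\in\vec\pi_i$, and let $D_{G,\vec\pi}(u)=\big([u]_{\vec\pi},\ [\sigma_1(u)]_{\vec\pi},[\sigma_2(u)]_{\vec\pi},\ \vec{\mathcal C}_G(u),\ (|\delta^i_G(u)\cap\vec\pi_1|,\dots,|\delta^i_G(u)\cap\vec\pi_m|,|\bar\delta^i_G(u)\cap\vec\pi_1|,\dots,|\bar\delta^i_G(u)\cap\vec\pi_m|)_{i=1,\dots,k}\big).$ Let $\vec\delta_G(\vec\pi)$ be the ordered partition of $V^k$ whose cells are the level sets of $D_{G,\vec\pi}$, ordered lexicographically by the value of $D_{G,\vec\pi}$. Let $\vec\delta^k_G$ be the ordered partition reached by iterating $\vec\delta_G$ from $(V^k)$ until it stabilises; similarly $\vec\delta^k_H$. The algorithm determines that $G$ and $H$ are not isomorphic iff there is no bijection $\gamma:V^k\to V^k$ with $D_{G,\vec\delta^k_G}(u)=D_{H,\vec\delta^k_H}(\gamma(u))$ for all $u\in V^k$. *)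

theory Defs
  imports
    "HOL-Analysis.Cartesian_Space"
    "HOL-Algebra.Sym_Groups"
    "HOL-Library.Poly_Mapping"
    "HOL-Library.List_Lexorder"
    "HOL-Library.FuncSet"
begin

section \<open>Graphs and the polytopes of fractional isomorphisms\<close>

text \<open>
  The vertex set is the universe of a finite type \<open>'n\<close>, so that \<open>n\<close> is \<open>CARD('n)\<close>;
  a graph is given by its edge set.
\<close>

definition simple_graph :: "'n::finite set set \<Rightarrow> bool" where
  "simple_graph E \<longleftrightarrow> (\<forall>e\<in>E. card e = 2)"

definition nbrs :: "'n::finite set set \<Rightarrow> 'n \<Rightarrow> 'n set" where
  "nbrs E a = {b. {a, b} \<in> E}"

definition adj_matrix :: "'n::finite set set \<Rightarrow> real^'n^'n" where
  "adj_matrix E = (\<chi> a b. if {a, b} \<in> E then 1 else 0)"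

definition iso_polytope :: "'n::finite set set \<Rightarrow> 'n set set \<Rightarrow> (real^'n^'n) set" where
  "iso_polytope G H =
     {X. (\<forall>u v. 0 \<le> X $ u $ v \<and> X $ u $ v \<le> 1) \<and>
         adj_matrix G ** X = X ** adj_matrix H \<and>
         X *v (\<chi> i. 1) = (\<chi> i. 1) \<and> transpose X *v (\<chi> i. 1) = (\<chi> i. 1)}"

section \<open>Sherali-Adams relaxations\<close>

text \<open>
  Real polynomials in variables indexed by \<open>'v\<close>: a monomial is a finitely supported map from
  variables to exponents, and multiplication is convolution.
\<close>

type_synonym 'v mpoly = "('v \<Rightarrow>\<^sub>0 nat) \<Rightarrow>\<^sub>0 real"

definition pvar :: "'v \<Rightarrow> 'v mpoly" where
  "pvar i = Poly_Mapping.single (Poly_Mapping.single i 1) 1"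

definition poly_eval :: "('v \<Rightarrow> real) \<Rightarrow> 'v mpoly \<Rightarrow> real" where
  "poly_eval x p = (\<Sum>m\<in>Poly_Mapping.keys p. Poly_Mapping.lookup p m *
                      (\<Prod>i\<in>Poly_Mapping.keys m. x i ^ Poly_Mapping.lookup m i))"

text \<open>
  Replacing \<open>x\<^sub>i\<^sup>2\<close> by \<open>x\<^sub>i\<close> exhaustively turns a monomial \<open>m\<close> into the
  product of the variables in its support \<open>keys m\<close>, which is then replaced by the
  value of \<open>y\<close> at that support (by 1 if the support is empty; \<open>y {}\<close> is never used).
\<close>

definition linearize :: "('v set \<Rightarrow> real) \<Rightarrow> 'v mpoly \<Rightarrow> real" where
  "linearize y p = (\<Sum>m\<in>Poly_Mapping.keys p. Poly_Mapping.lookup p m *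
                      (if Poly_Mapping.keys m = {} then 1 else y (Poly_Mapping.keys m)))"

text \<open>
  \<open>F\<close> and \<open>P\<close> are the sets of polynomials required to vanish and to be
  nonnegative, respectively, on the relaxed region of the unit cube.
\<close>

definition sa_lifted ::
    "nat \<Rightarrow> 'v::finite mpoly set \<Rightarrow> 'v mpoly set \<Rightarrow> ('v set \<Rightarrow> real) set" where
  "sa_lifted k F P =
     {y. (\<forall>f\<in>F. \<forall>I. card I \<le> k - 1 \<longrightarrow> linearize y ((\<Prod>i\<in>I. pvar i) * f) = 0) \<and>
         (\<forall>g\<in>P. \<forall>J I. I \<subseteq> J \<and> card J \<le> k - 1 \<longrightarrow>
            linearize y ((\<Prod>i\<in>I. pvar i) * (\<Prod>i\<in>J - I. 1 - pvar i) * g) \<ge> 0) \<and>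
         (\<forall>J I. I \<subseteq> J \<and> card J \<le> k \<longrightarrow>
            linearize y ((\<Prod>i\<in>I. pvar i) * (\<Prod>i\<in>J - I. 1 - pvar i)) \<ge> 0)}"

definition sherali_adams ::
    "nat \<Rightarrow> 'v::finite mpoly set \<Rightarrow> 'v mpoly set \<Rightarrow> ('v \<Rightarrow> real) set" where
  "sherali_adams k F P = {x. \<exists>y\<in>sa_lifted k F P. \<forall>i. x i = y {i}}"

text \<open>
  The equations defining \<open>iso_polytope\<close>: row sums, column sums, and the entries of
  \<open>A\<^sub>G X - X A\<^sub>H\<close>.
\<close>

definition iso_polys :: "'n::finite set set \<Rightarrow> 'n set set \<Rightarrow> ('n \<times> 'n) mpoly set" where
  "iso_polys G H =
     {(\<Sum>v\<in>UNIV. pvar (u, v)) - 1 | u. True} \<union>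
     {(\<Sum>u\<in>UNIV. pvar (u, v)) - 1 | v. True} \<union>
     {(\<Sum>w\<in>nbrs G u. pvar (w, v)) - (\<Sum>w\<in>nbrs H v. pvar (u, w)) | u v. True}"

definition iso_relaxation ::
    "nat \<Rightarrow> 'n::finite set set \<Rightarrow> 'n set set \<Rightarrow> (real^'n^'n) set" where
  "iso_relaxation k G H = {X. (\<lambda>(u, v). X $ u $ v) \<in> sherali_adams k (iso_polys G H) {}}"

lemma poly_eval_superset:
  assumes "finite S" "Poly_Mapping.keys p \<subseteq> S"
  shows "poly_eval x p = (\<Sum>m\<in>S. Poly_Mapping.lookup p m *
                      (\<Prod>i\<in>Poly_Mapping.keys m. x i ^ Poly_Mapping.lookup m i))"
  unfolding poly_eval_def using assms
  by (intro sum.mono_neutral_left) (auto simp: in_keys_iff)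

lemma poly_eval_diff: "poly_eval x (p - q) = poly_eval x p - poly_eval x q"
proof -
  let ?S = "Poly_Mapping.keys p \<union> Poly_Mapping.keys q"
  have "Poly_Mapping.keys (p - q) \<subseteq> ?S"
    by (auto simp: in_keys_iff lookup_minus)
  then show ?thesis
    by (simp add: poly_eval_superset[of ?S] lookup_minus left_diff_distrib sum_subtractf)
qed

lemma poly_eval_add: "poly_eval x (p + q) = poly_eval x p + poly_eval x q"
proof -
  let ?S = "Poly_Mapping.keys p \<union> Poly_Mapping.keys q"
  have "Poly_Mapping.keys (p + q) \<subseteq> ?S"
    by (rule Poly_Mapping.keys_add)
  then show ?thesis
    by (simp add: poly_eval_superset[of ?S] lookup_add distrib_right sum.distrib)
qed

lemma poly_eval_sum: "poly_eval x (\<Sum>a\<in>A. p a) = (\<Sum>a\<in>A. poly_eval x (p a))"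
proof (induction A rule: infinite_finite_induct)
  case (insert a A)
  then show ?case by (simp add: poly_eval_add)
qed (simp_all add: poly_eval_def)

lemma poly_eval_pvar: "poly_eval x (pvar i) = x i"
  by (simp add: poly_eval_def pvar_def)

lemma poly_eval_one: "poly_eval x 1 = 1"
  by (simp add: poly_eval_def)

lemma iso_polytope_polys:
  "iso_polytope G H =
     {X. (\<forall>u v. 0 \<le> X $ u $ v \<and> X $ u $ v \<le> 1) \<and>
         (\<forall>f\<in>iso_polys G H. poly_eval (\<lambda>(u, v). X $ u $ v) f = 0)}"
proof -
  have comm: "(adj_matrix G ** X = X ** adj_matrix H) \<longleftrightarrow>
      (\<forall>u v. (\<Sum>w\<in>nbrs G u. X $ w $ v) = (\<Sum>w\<in>nbrs H v. X $ u $ w))" for X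
  proof -
    have 1: "(adj_matrix G ** X) $ u $ v = (\<Sum>w\<in>nbrs G u. X $ w $ v)" for u v
      by (simp add: matrix_matrix_mult_def adj_matrix_def nbrs_def sum.If_cases
          if_distrib[of "\<lambda>t. t * _"] cong: if_cong)
    have 2: "(X ** adj_matrix H) $ u $ v = (\<Sum>w\<in>nbrs H v. X $ u $ w)" for u v
      by (simp add: matrix_matrix_mult_def adj_matrix_def nbrs_def sum.If_cases insert_commute
          if_distrib[of "\<lambda>t. _ * t"] cong: if_cong)
    show ?thesis by (simp add: vec_eq_iff 1 2)
  qed
  have row: "(X *v (\<chi> i. 1) = (\<chi> i. 1)) \<longleftrightarrow> (\<forall>u. (\<Sum>v\<in>UNIV. X $ u $ v) = 1)"
    for X :: "real^'a^'a"
    by (simp add: vec_eq_iff matrix_vector_mult_def)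
  have col: "(Finite_Cartesian_Product.transpose X *v (\<chi> i. 1) = (\<chi> i. 1)) \<longleftrightarrow> (\<forall>v. (\<Sum>u\<in>UNIV. X $ u $ v) = 1)"
    for X :: "real^'a^'a"
    by (simp add: vec_eq_iff matrix_vector_mult_def transpose_def)
  have ball: "(\<forall>f\<in>iso_polys G H. Q f) \<longleftrightarrow>
      (\<forall>u. Q ((\<Sum>v\<in>UNIV. pvar (u, v)) - 1)) \<and> (\<forall>v. Q ((\<Sum>u\<in>UNIV. pvar (u, v)) - 1)) \<and>
      (\<forall>u v. Q ((\<Sum>w\<in>nbrs G u. pvar (w, v)) - (\<Sum>w\<in>nbrs H v. pvar (u, w))))" for Q
    unfolding iso_polys_def by blast
  show ?thesis
    unfolding iso_polytope_def ball comm row col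
      poly_eval_diff poly_eval_sum poly_eval_pvar poly_eval_one
    by (simp add: Finite_Cartesian_Product.transpose_def) blast
qed

section \<open>Tuples\<close>

text \<open>
  A \<open>k\<close>-tuple is an extensional function on \<open>{1..k}\<close>. For \<open>\<sigma>\<close> in
  \<open>S\<^sub>k\<close>, which fixes everything outside \<open>{1..k}\<close>, the tuple with entries
  \<open>u (\<sigma> i)\<close> is \<open>u \<circ> \<sigma>\<close>, and \<open>\<phi>\<^sub>i(u, w)\<close> is \<open>u(i := w)\<close>.
\<close>

definition tuples :: "nat \<Rightarrow> (nat \<Rightarrow> 'n::finite) set" where
  "tuples k = {1..k} \<rightarrow>\<^sub>E UNIV"

definition tuple_nbrs :: "'n::finite set set \<Rightarrow> nat \<Rightarrow> (nat \<Rightarrow> 'n) \<Rightarrow> (nat \<Rightarrow> 'n) set" where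
  "tuple_nbrs G i u = {u(i := w) | w. w \<in> nbrs G (u i)}"

definition tuple_nonnbrs :: "'n::finite set set \<Rightarrow> nat \<Rightarrow> (nat \<Rightarrow> 'n) \<Rightarrow> (nat \<Rightarrow> 'n) set" where
  "tuple_nonnbrs G i u = {u(i := w) | w. w \<notin> nbrs G (u i)}"

definition comb_entry :: "'n::finite set set \<Rightarrow> (nat \<Rightarrow> 'n) \<Rightarrow> nat \<Rightarrow> nat \<Rightarrow> int" where
  "comb_entry G u i j = (if u i = u j then 0 else if {u i, u j} \<in> G then 1 else -1)"

definition comb_matrix :: "nat \<Rightarrow> 'n::finite set set \<Rightarrow> (nat \<Rightarrow> 'n) \<Rightarrow> int list list" where
  "comb_matrix k G u =
     map (\<lambda>i. map (\<lambda>j. comb_entry G u i j) [1..<k+1]) [1..<k+1]"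

definition generates_sym :: "nat \<Rightarrow> (nat \<Rightarrow> nat) \<Rightarrow> (nat \<Rightarrow> nat) \<Rightarrow> bool" where
  "generates_sym k \<sigma>1 \<sigma>2 \<longleftrightarrow> \<sigma>1 permutes {1..k} \<and> \<sigma>2 permutes {1..k} \<and>
     generate (sym_group k) {\<sigma>1, \<sigma>2} = carrier (sym_group k)"

section \<open>The C-V-C algorithm\<close>

text \<open>
  The first fixed point among the iterates of \<open>f\<close> from \<open>x\<close>. It exists
  in the uses below, since both refinement steps refine a partition of a finite set.
\<close>

definition iterate_until_stable :: "('a \<Rightarrow> 'a) \<Rightarrow> 'a \<Rightarrow> 'a" where
  "iterate_until_stable f x = (f ^^ (LEAST t. (f ^^ Suc t) x = (f ^^ t) x)) x"

subsection \<open>Automorphism version\<close>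

definition same_cell :: "'a set set \<Rightarrow> 'a \<Rightarrow> 'a \<Rightarrow> bool" where
  "same_cell \<pi> u v \<longleftrightarrow> (\<exists>C\<in>\<pi>. u \<in> C \<and> v \<in> C)"

definition cvc_equiv ::
    "nat \<Rightarrow> (nat \<Rightarrow> nat) \<Rightarrow> (nat \<Rightarrow> nat) \<Rightarrow> 'n::finite set set \<Rightarrow> (nat \<Rightarrow> 'n) set set \<Rightarrow>
     ((nat \<Rightarrow> 'n) \<times> (nat \<Rightarrow> 'n)) set" where
  "cvc_equiv k \<sigma>1 \<sigma>2 G \<pi> =
     {(u, v). u \<in> tuples k \<and> v \<in> tuples k \<and> same_cell \<pi> u v \<and>
        same_cell \<pi> (u \<circ> \<sigma>1) (v \<circ> \<sigma>1) \<and> same_cell \<pi> (u \<circ> \<sigma>2) (v \<circ> \<sigma>2) \<and>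
        comb_matrix k G u = comb_matrix k G v \<and>
        (\<forall>C\<in>\<pi>. \<forall>i\<in>{1..k}.
           card (tuple_nbrs G i u \<inter> C) = card (tuple_nbrs G i v \<inter> C) \<and>
           card (tuple_nonnbrs G i u \<inter> C) = card (tuple_nonnbrs G i v \<inter> C))}"

definition cvc_refine ::
    "nat \<Rightarrow> (nat \<Rightarrow> nat) \<Rightarrow> (nat \<Rightarrow> nat) \<Rightarrow> 'n::finite set set \<Rightarrow> (nat \<Rightarrow> 'n) set set \<Rightarrow>
     (nat \<Rightarrow> 'n) set set" where
  "cvc_refine k \<sigma>1 \<sigma>2 G \<pi> = tuples k // cvc_equiv k \<sigma>1 \<sigma>2 G \<pi>"

definition cvc_stable ::
    "nat \<Rightarrow> (nat \<Rightarrow> nat) \<Rightarrow> (nat \<Rightarrow> nat) \<Rightarrow> 'n::finite set set \<Rightarrow> (nat \<Rightarrow> 'n) set set" where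
  "cvc_stable k \<sigma>1 \<sigma>2 G = iterate_until_stable (cvc_refine k \<sigma>1 \<sigma>2 G) {tuples k}"

definition cvc_determines_asymmetric ::
    "nat \<Rightarrow> (nat \<Rightarrow> nat) \<Rightarrow> (nat \<Rightarrow> nat) \<Rightarrow> 'n::finite set set \<Rightarrow> bool" where
  "cvc_determines_asymmetric k \<sigma>1 \<sigma>2 G \<longleftrightarrow> (\<forall>C\<in>cvc_stable k \<sigma>1 \<sigma>2 G. is_singleton C)"

subsection \<open>Isomorphism version\<close>

text \<open>Ordered partitions are lists of cells, numbered from 1.\<close>

definition cell_index :: "'a set list \<Rightarrow> 'a \<Rightarrow> nat" where
  "cell_index \<pi> u = (THE i. i \<in> {1..length \<pi>} \<and> u \<in> \<pi> ! (i - 1))"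

text \<open>
  The value \<open>D\<^bsub>G,\<pi>\<^esub>(u)\<close> as a flat list of integers, with the matrix written row
  by row. For fixed \<open>k \<ge> 1\<close> its length determines the number of cells, hence
  the flattening is injective, also across different partitions.
\<close>

definition cvc_value ::
    "nat \<Rightarrow> (nat \<Rightarrow> nat) \<Rightarrow> (nat \<Rightarrow> nat) \<Rightarrow> 'n::finite set set \<Rightarrow> (nat \<Rightarrow> 'n) set list \<Rightarrow>
     (nat \<Rightarrow> 'n) \<Rightarrow> int list" where
  "cvc_value k \<sigma>1 \<sigma>2 G \<pi> u =
     [int (cell_index \<pi> u), int (cell_index \<pi> (u \<circ> \<sigma>1)), int (cell_index \<pi> (u \<circ> \<sigma>2))] @
     concat (comb_matrix k G u) @
     concat (map (\<lambda>i. map (\<lambda>C. int (card (tuple_nbrs G i u \<inter> C))) \<pi> @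
                      map (\<lambda>C. int (card (tuple_nonnbrs G i u \<inter> C))) \<pi>) [1..<k+1])"

text \<open>The order on \<open>int list\<close> is the lexicographic one of \<^theory>\<open>HOL-Library.List_Lexorder\<close>.\<close>

definition cvc_ord_refine ::
    "nat \<Rightarrow> (nat \<Rightarrow> nat) \<Rightarrow> (nat \<Rightarrow> nat) \<Rightarrow> 'n::finite set set \<Rightarrow> (nat \<Rightarrow> 'n) set list \<Rightarrow>
     (nat \<Rightarrow> 'n) set list" where
  "cvc_ord_refine k \<sigma>1 \<sigma>2 G \<pi> =
     map (\<lambda>d. {u \<in> tuples k. cvc_value k \<sigma>1 \<sigma>2 G \<pi> u = d})
       (sorted_list_of_set (cvc_value k \<sigma>1 \<sigma>2 G \<pi> ` tuples k))"

definition cvc_ord_stable ::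
    "nat \<Rightarrow> (nat \<Rightarrow> nat) \<Rightarrow> (nat \<Rightarrow> nat) \<Rightarrow> 'n::finite set set \<Rightarrow> (nat \<Rightarrow> 'n) set list" where
  "cvc_ord_stable k \<sigma>1 \<sigma>2 G = iterate_until_stable (cvc_ord_refine k \<sigma>1 \<sigma>2 G) [tuples k]"

definition cvc_determines_nonisomorphic ::
    "nat \<Rightarrow> (nat \<Rightarrow> nat) \<Rightarrow> (nat \<Rightarrow> nat) \<Rightarrow> 'n::finite set set \<Rightarrow> 'n set set \<Rightarrow> bool" where
  "cvc_determines_nonisomorphic k \<sigma>1 \<sigma>2 G H \<longleftrightarrow>
     \<not> (\<exists>\<gamma>. bij_betw \<gamma> (tuples k) (tuples k) \<and>
            (\<forall>u\<in>tuples k. cvc_value k \<sigma>1 \<sigma>2 G (cvc_ord_stable k \<sigma>1 \<sigma>2 G) u =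
                           cvc_value k \<sigma>1 \<sigma>2 H (cvc_ord_stable k \<sigma>1 \<sigma>2 H) (\<gamma> u)))"

end

theory Submission
  imports Defs
begin

text \<open>
  A point \<open>y\<close> of the lifted polyhedron yields a matrix \<open>Y(u, v) = y {(u\<^sub>i, v\<^sub>i) | i}\<close> indexed
  by pairs of \<open>k\<close>-tuples. The linearized equations imply that \<open>Y\<close> is doubly stochastic
  and intertwines, coordinate by coordinate, the adjacencies of \<open>G\<close> and \<open>H\<close>; the support of
  such a matrix respects every round of the refinement, which gives one direction of both
  equivalences. Conversely, for stable colourings with matching class sizes, let \<open>Y(u, v)\<close> be the
  inverse size of the class of \<open>u\<close> if \<open>u\<close> and \<open>v\<close> have the same colour, and \<open>0\<close> otherwise.
  Stability under permuting coordinates and under copying one coordinate to another shows that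
  \<open>Y(u, v)\<close> only depends on the set of pairs \<open>(u\<^sub>i, v\<^sub>i)\<close>, and double counting gives the
  equations. The inequalities follow from nonnegativity of \<open>y\<close> and the row sums.
\<close>

section \<open>Linearized constraints\<close>

text \<open>The obstacle is a mismatch of indexing: the constraints speak of sets of at most
  \<open>k\<close> pairs, the refinement of ordered tuples with repetitions. The algorithm sees
  permutations only through two generators, and it never records the copying of a coordinate;
  copying has to be extracted from the replacement counts together with the equality pattern in the
  matrix. The weight has a model: if the colours were orbits under isomorphisms, it would be the
  probability that a uniformly random isomorphism maps \<open>u\<close> to \<open>v\<close>. For
  \<open>k \<ge> 1\<close> the empty set of pairs belongs to no tuple, so the equations at
  \<open>I = {}\<close> need arguments of their own.\<close>

text \<open>Assigning 1 to the empty set absorbs the exception for the empty monomial, so that the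
  equations take the same form for empty and nonempty \<open>I\<close>.\<close>

definition support_value :: "('v set \<Rightarrow> real) \<Rightarrow> 'v set \<Rightarrow> real" where
  "support_value y S = (if S = {} then 1 else y S)"

lemma linearize_superset:
  assumes "finite S" "Poly_Mapping.keys p \<subseteq> S"
  shows "linearize y p =
    (\<Sum>m\<in>S. Poly_Mapping.lookup p m * support_value y (Poly_Mapping.keys m))"
  unfolding linearize_def support_value_def using assms
  by (intro sum.mono_neutral_left) (auto simp: in_keys_iff)

lemma linearize_add: "linearize y (p + q) = linearize y p + linearize y q"
proof -
  let ?S = "Poly_Mapping.keys p \<union> Poly_Mapping.keys q"
  have "Poly_Mapping.keys (p + q) \<subseteq> ?S"
    by (rule Poly_Mapping.keys_add)
  then show ?thesis
    by (simp add: linearize_superset[of ?S] lookup_add distrib_right sum.distrib)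
qed

lemma linearize_diff: "linearize y (p - q) = linearize y p - linearize y q"
proof -
  let ?S = "Poly_Mapping.keys p \<union> Poly_Mapping.keys q"
  have "Poly_Mapping.keys (p - q) \<subseteq> ?S"
    by (auto simp: in_keys_iff lookup_minus)
  then show ?thesis
    by (simp add: linearize_superset[of ?S] lookup_minus left_diff_distrib sum_subtractf)
qed

lemma linearize_sum: "linearize y (\<Sum>a\<in>A. p a) = (\<Sum>a\<in>A. linearize y (p a))"
proof (induction A rule: infinite_finite_induct)
  case (insert a A)
  then show ?case by (simp add: linearize_add)
qed (simp_all add: linearize_def)

lemma linearize_single:
  "linearize y (Poly_Mapping.single m 1) = support_value y (Poly_Mapping.keys m)"
  by (simp add: linearize_def support_value_def)

text \<open>Exponents are natural numbers and cannot cancel, so a further factor only adds its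
  variable to the support, and the support is all that linearization sees.\<close>

lemma keys_plus_var:
  fixes m :: "'v \<Rightarrow>\<^sub>0 nat"
  shows "Poly_Mapping.keys (m + Poly_Mapping.single i 1) = insert i (Poly_Mapping.keys m)"
  by (auto simp: in_keys_iff lookup_add lookup_single when_def split: if_splits)

lemma prod_pvar:
  assumes "finite I"
  shows "(\<Prod>i\<in>I. pvar i) = Poly_Mapping.single (\<Sum>i\<in>I. Poly_Mapping.single i 1) 1"
  using assms
  by (induction I) (simp_all add: pvar_def mult_single)

lemma keys_sum_var:
  fixes I :: "'v set"
  assumes "finite I"
  shows "Poly_Mapping.keys (\<Sum>i\<in>I. Poly_Mapping.single i 1 :: 'v \<Rightarrow>\<^sub>0 nat) = I"
  using assms
proof (induction I)
  case (insert i I)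
  then show ?case
    using keys_plus_var[of "\<Sum>i\<in>I. Poly_Mapping.single i 1" i] by (simp add: add.commute)
qed simp

lemma linearize_prod:
  assumes "finite I"
  shows "linearize y (\<Prod>i\<in>I. pvar i) = support_value y I"
  using assms by (simp add: prod_pvar linearize_single keys_sum_var del: One_nat_def)

lemma linearize_prod_pvar:
  assumes "finite I"
  shows "linearize y ((\<Prod>i\<in>I. pvar i) * pvar j) = support_value y (insert j I)"
  using assms unfolding prod_pvar[OF assms]
  by (simp add: pvar_def mult_single linearize_single keys_sum_var keys_plus_var del: One_nat_def)

section \<open>Products with complemented factors\<close>

definition cube_part :: "'v set \<Rightarrow> 'v mpoly" where
  "cube_part N = (\<Prod>i\<in>N. 1 - pvar i)"

text \<open>Expanding one factor \<open>1 - pvar p\<close> gives the recursion behind all inductions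
  over the set of complemented variables.\<close>

lemma linearize_cube_part_insert:
  fixes m :: "'v \<Rightarrow>\<^sub>0 nat"
  assumes "finite N" "p \<notin> N"
  shows "linearize y (Poly_Mapping.single m 1 * cube_part (insert p N)) =
    linearize y (Poly_Mapping.single m 1 * cube_part N) -
    linearize y (Poly_Mapping.single (m + Poly_Mapping.single p 1) 1 * cube_part N)"
proof -
  have "Poly_Mapping.single m 1 * cube_part (insert p N) =
    Poly_Mapping.single m 1 * cube_part N -
    (Poly_Mapping.single m 1 * Poly_Mapping.single (Poly_Mapping.single p 1) 1) * cube_part N"
    using assms by (simp add: cube_part_def pvar_def algebra_simps)
  then show ?thesis by (simp add: mult_single linearize_diff)
qed

text \<open>The recursion can raise an exponent to 2; this lemma is the rule that squares count as
  first powers, in the presence of complemented factors.\<close>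

lemma linearize_cube_part_cong:
  fixes m m' :: "'v \<Rightarrow>\<^sub>0 nat"
  assumes "finite N" "Poly_Mapping.keys m = Poly_Mapping.keys m'"
  shows "linearize y (Poly_Mapping.single m 1 * cube_part N) =
    linearize y (Poly_Mapping.single m' 1 * cube_part N)"
  using assms
proof (induction N arbitrary: m m')
  case empty
  then show ?case by (simp add: cube_part_def linearize_single)
next
  case (insert p N)
  have "linearize y (Poly_Mapping.single (m + Poly_Mapping.single p 1) 1 * cube_part N) =
    linearize y (Poly_Mapping.single (m' + Poly_Mapping.single p 1) 1 * cube_part N)"
    by (rule insert.IH) (simp only: keys_plus_var insert.prems)
  then show ?case
    using insert.IH[OF insert.prems] insert.hyps by (simp add: linearize_cube_part_insert)
qed

text \<open>The pair \<open>(u, v)\<close> may already lie in \<open>I\<close>. Then the summand at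
  \<open>v\<close> in row \<open>u\<close> is \<open>Y I\<close> itself and the remaining summands
  add up to 0; this is the source of all vanishing entries used below.\<close>

definition relaxed_iso ::
    "nat \<Rightarrow> 'n::finite set set \<Rightarrow> 'n set set \<Rightarrow> (('n \<times> 'n) set \<Rightarrow> real) \<Rightarrow> bool" where
  "relaxed_iso k G H Y \<longleftrightarrow> Y {} = 1 \<and> (\<forall>S. card S \<le> k \<longrightarrow> 0 \<le> Y S) \<and>
     (\<forall>I. card I \<le> k - 1 \<longrightarrow>
       (\<forall>u. (\<Sum>v\<in>UNIV. Y (insert (u, v) I)) = Y I) \<and>
       (\<forall>v. (\<Sum>u\<in>UNIV. Y (insert (u, v) I)) = Y I) \<and>
       (\<forall>u v. (\<Sum>w\<in>nbrs G u. Y (insert (w, v) I)) = (\<Sum>w\<in>nbrs H v. Y (insert (u, w) I))))"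

text \<open>Since row \<open>u\<close> sums to 1, the factor \<open>1 - x\<^bsub>(u, v)\<^esub>\<close> may be replaced by the sum of the
  \<open>x\<^bsub>(u, w)\<^esub>\<close> with \<open>w \<noteq> v\<close>.\<close>

lemma linearize_cube_part_nonneg:
  fixes N :: "('n::finite \<times> 'n) set"
  assumes rel: "relaxed_iso k G H (support_value y)"
    and "card (Poly_Mapping.keys m \<union> N) \<le> k"
  shows "0 \<le> linearize y (Poly_Mapping.single m 1 * cube_part N)"
proof -
  have "finite N" by simp
  then show ?thesis using assms(2)
  proof (induction N arbitrary: m)
    case empty
    then show ?case using rel by (simp add: cube_part_def linearize_single relaxed_iso_def)
  next
    case (insert p N)
    obtain u v where p: "p = (u, v)" by (cases p)
    show ?case
    proof (cases "p \<in> Poly_Mapping.keys m")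
      \<comment> \<open>The complemented factor meets its own variable: \<open>x * (1 - x)\<close>
        linearizes to 0.\<close>
      case True
      then have "Poly_Mapping.keys (m + Poly_Mapping.single p 1) = Poly_Mapping.keys m"
        unfolding keys_plus_var by blast
      then have "linearize y (Poly_Mapping.single (m + Poly_Mapping.single p 1) 1 * cube_part N) =
          linearize y (Poly_Mapping.single m 1 * cube_part N)"
        by (intro linearize_cube_part_cong) simp_all
      then show ?thesis using insert.hyps by (simp add: linearize_cube_part_insert)
    next
      case False
      define F where "F = (\<lambda>(N::('n \<times> 'n) set) m. linearize y (Poly_Mapping.single m 1 * cube_part N))"
      \<comment> \<open>The row equation for \<open>u\<close> survives multiplication by
        complemented factors; the bound \<open>k - 1\<close> leaves room for the extra pair
        \<open>(u, w)\<close>.\<close>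
      have expand: "F N m = (\<Sum>w\<in>UNIV. F N (m + Poly_Mapping.single (u, w) 1))"
        if "card (Poly_Mapping.keys m \<union> N) \<le> k - 1" for N m
      proof -
        have "finite N" by simp
        then show ?thesis using that
        proof (induction N arbitrary: m)
          case empty
          then show ?case using rel
            by (simp only: F_def cube_part_def prod.empty mult_1_right linearize_single keys_plus_var
                relaxed_iso_def) simp
        next
          case (insert q N)
          have c1: "card (Poly_Mapping.keys m \<union> N) \<le> k - 1"
            by (rule order_trans[OF card_mono insert.prems]) auto
          have c2: "card (Poly_Mapping.keys (m + Poly_Mapping.single q 1) \<union> N) \<le> k - 1"
            using insert.prems unfolding keys_plus_var by simp
          have "F (insert q N) m' = F N m' - F N (m' + Poly_Mapping.single q 1)" for m'
            using insert.hyps by (simp add: F_def linearize_cube_part_insert)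
          then show ?case
            using insert.IH[OF c1] insert.IH[OF c2]
            by (simp add: sum_subtractf add_ac)
        qed
      qed
      have "card (insert p (Poly_Mapping.keys m \<union> N)) \<le> k"
        using insert.prems by simp
      \<comment> \<open>Since \<open>p\<close> is neither in the support nor in \<open>N\<close>,
        dropping it frees the place that \<open>(u, w)\<close> needs.\<close>
      then have c: "card (Poly_Mapping.keys m \<union> N) + 1 \<le> k"
        using False insert.hyps by simp
      have "F (insert p N) m = F N m - F N (m + Poly_Mapping.single (u, v) 1)"
        using insert.hyps by (simp add: F_def linearize_cube_part_insert p)
      also have "F N m = (\<Sum>w\<in>UNIV. F N (m + Poly_Mapping.single (u, w) 1))"
        using c by (intro expand) linarith
      also have "\<dots> - F N (m + Poly_Mapping.single (u, v) 1) =
          (\<Sum>w\<in>UNIV - {v}. F N (m + Poly_Mapping.single (u, w) 1))"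
        by (simp add: sum_diff1)
      finally have eq: "F (insert p N) m = \<dots>" .
      have "0 \<le> F N (m + Poly_Mapping.single (u, w) 1)" for w
      proof -
        have "card (Poly_Mapping.keys (m + Poly_Mapping.single (u, w) 1) \<union> N) \<le> k"
          unfolding keys_plus_var using c card_insert_le_m1
          by (simp add: card_insert_if)
        then show ?thesis unfolding F_def by (rule insert.IH)
      qed
      then have "0 \<le> F (insert p N) m" unfolding eq by (intro sum_nonneg) blast
      then show ?thesis by (simp add: F_def)
    qed
  qed
qed

text \<open>The choice \<open>I = J\<close> in the inequalities gives nonnegativity of
  \<open>y\<close>; the inequalities with complemented factors are recovered from
  \<open>linearize_cube_part_nonneg\<close>.\<close>

lemma sa_lifted_iff:
  "y \<in> sa_lifted k (iso_polys G H) {} \<longleftrightarrow> relaxed_iso k G H (support_value y)"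
proof -
  have ball: "(\<forall>f\<in>iso_polys G H. Q f) \<longleftrightarrow>
      (\<forall>u. Q ((\<Sum>v\<in>UNIV. pvar (u, v)) - 1)) \<and> (\<forall>v. Q ((\<Sum>u\<in>UNIV. pvar (u, v)) - 1)) \<and>
      (\<forall>u v. Q ((\<Sum>w\<in>nbrs G u. pvar (w, v)) - (\<Sum>w\<in>nbrs H v. pvar (u, w))))" for Q
    unfolding iso_polys_def by blast
  have eqs: "(\<forall>f\<in>iso_polys G H. \<forall>I. card I \<le> k - 1 \<longrightarrow> linearize y ((\<Prod>i\<in>I. pvar i) * f) = 0)
    \<longleftrightarrow> (\<forall>I. card I \<le> k - 1 \<longrightarrow>
       (\<forall>u. (\<Sum>v\<in>UNIV. support_value y (insert (u, v) I)) = support_value y I) \<and>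
       (\<forall>v. (\<Sum>u\<in>UNIV. support_value y (insert (u, v) I)) = support_value y I) \<and>
       (\<forall>u v. (\<Sum>w\<in>nbrs G u. support_value y (insert (w, v) I)) =
              (\<Sum>w\<in>nbrs H v. support_value y (insert (u, w) I))))"
    unfolding ball
    by (simp add: right_diff_distrib sum_distrib_left linearize_diff linearize_sum
        linearize_prod_pvar linearize_prod) blast
  have "(\<forall>J I. I \<subseteq> J \<and> card J \<le> k \<longrightarrow>
            linearize y ((\<Prod>i\<in>I. pvar i) * (\<Prod>i\<in>J - I. 1 - pvar i)) \<ge> 0)"
    if rel: "relaxed_iso k G H (support_value y)"
  proof (intro allI impI)
    fix J I :: "('a \<times> 'a) set" assume "I \<subseteq> J \<and> card J \<le> k"
    then have "card (Poly_Mapping.keys (\<Sum>i\<in>I. Poly_Mapping.single i 1 :: _ \<Rightarrow>\<^sub>0 nat) \<union> (J - I)) \<le> k"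
      by (simp add: keys_sum_var Un_absorb1 del: One_nat_def)
    from linearize_cube_part_nonneg[OF rel this]
    show "linearize y ((\<Prod>i\<in>I. pvar i) * (\<Prod>i\<in>J - I. 1 - pvar i)) \<ge> 0"
      by (simp add: cube_part_def prod_pvar)
  qed
  moreover have "0 \<le> support_value y S"
    if "\<forall>J I. I \<subseteq> J \<and> card J \<le> k \<longrightarrow>
            linearize y ((\<Prod>i\<in>I. pvar i) * (\<Prod>i\<in>J - I. 1 - pvar i)) \<ge> 0" "card S \<le> k" for S
    using that(1)[rule_format, of S S] that(2) by (simp add: linearize_prod)
  ultimately show ?thesis
    unfolding sa_lifted_def mem_Collect_eq eqs
    by (auto simp: relaxed_iso_def) (auto simp: support_value_def)
qed

text \<open>This is where polynomials leave the argument. The normalization \<open>Y {} = 1\<close>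
  makes \<open>support_value Y\<close> equal to \<open>Y\<close>, so any solution is itself a lifted
  point.\<close>

lemma iso_relaxation_iff:
  fixes X :: "real^'n::finite^'n"
  shows "X \<in> iso_relaxation k G H \<longleftrightarrow>
    (\<exists>Y. relaxed_iso k G H Y \<and> (\<forall>u v. X $ u $ v = Y {(u, v)}))"
proof
  assume "X \<in> iso_relaxation k G H"
  then obtain y where y: "y \<in> sa_lifted k (iso_polys G H) {}"
    and X: "\<And>i. (\<lambda>(u, v). X $ u $ v) i = y {i}"
    by (auto simp: iso_relaxation_def sherali_adams_def)
  have "X $ u $ v = support_value y {(u, v)}" for u v
    using X[of "(u, v)"] by (simp add: support_value_def)
  then show "\<exists>Y. relaxed_iso k G H Y \<and> (\<forall>u v. X $ u $ v = Y {(u, v)})"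
    using y unfolding sa_lifted_iff by blast
next
  assume "\<exists>Y. relaxed_iso k G H Y \<and> (\<forall>u v. X $ u $ v = Y {(u, v)})"
  then obtain Y where Y: "relaxed_iso k G H Y" "\<And>u v. X $ u $ v = Y {(u, v)}" by blast
  have "support_value Y = Y"
    using Y(1) by (auto simp: support_value_def relaxed_iso_def fun_eq_iff)
  then have "Y \<in> sa_lifted k (iso_polys G H) {}"
    using Y(1) by (simp add: sa_lifted_iff)
  then show "X \<in> iso_relaxation k G H"
    using Y(2) by (auto simp: iso_relaxation_def sherali_adams_def)
qed

section \<open>Doubly stochastic matrices and colour refinement\<close>

text \<open>Row \<open>u\<close> is a probability distribution concentrated on elements with the
  colour of \<open>u\<close>, so averaging the indicator of a colour over it returns that indicator
  at \<open>u\<close>.\<close>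

lemma weighted_indicator_transport:
  fixes Y :: "'a \<Rightarrow> 'b \<Rightarrow> real"
  assumes row: "\<And>u. u \<in> S \<Longrightarrow> (\<Sum>v\<in>T. Y u v) = 1"
    and nonneg: "\<And>u v. u \<in> S \<Longrightarrow> v \<in> T \<Longrightarrow> 0 \<le> Y u v"
    and supp: "\<And>u v. u \<in> S \<Longrightarrow> v \<in> T \<Longrightarrow> 0 < Y u v \<Longrightarrow> f u = g v"
    and u: "u \<in> S"
  shows "(\<Sum>v\<in>T. Y u v * of_bool (g v = d)) = of_bool (f u = d)"
proof -
  have "Y u v * of_bool (g v = d) = Y u v * of_bool (f u = d)" if "v \<in> T" for v
    using supp[OF u that] nonneg[OF u that] by (cases "Y u v = 0") auto
  then have "(\<Sum>v\<in>T. Y u v * of_bool (g v = d)) = (\<Sum>v\<in>T. Y u v) * of_bool (f u = d)"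
    unfolding sum_distrib_right by (rule sum.cong[OF refl])
  then show ?thesis using row[OF u] by simp
qed

text \<open>The mass of \<open>Y\<close> between the two classes of colour \<open>d\<close> is
  computed once by rows and once by columns.\<close>

lemma doubly_stochastic_class_card:
  fixes Y :: "'a \<Rightarrow> 'b \<Rightarrow> real"
  assumes fin: "finite S" "finite T"
    and row: "\<And>u. u \<in> S \<Longrightarrow> (\<Sum>v\<in>T. Y u v) = 1"
    and col: "\<And>v. v \<in> T \<Longrightarrow> (\<Sum>u\<in>S. Y u v) = 1"
    and nonneg: "\<And>u v. u \<in> S \<Longrightarrow> v \<in> T \<Longrightarrow> 0 \<le> Y u v"
    and supp: "\<And>u v. u \<in> S \<Longrightarrow> v \<in> T \<Longrightarrow> 0 < Y u v \<Longrightarrow> f u = g v"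
  shows "card {u\<in>S. f u = d} = card {v\<in>T. g v = d}"
proof -
  have t: "(\<Sum>v\<in>T. Y u v * of_bool (g v = d)) = of_bool (f u = d)" if "u \<in> S" for u
    by (rule weighted_indicator_transport[where S = S]) (use row nonneg supp that in auto)
  have "real (card {u\<in>S. f u = d}) = (\<Sum>u\<in>S. of_bool (f u = d))"
    using fin by (simp add: of_bool_def sum.If_cases Int_def)
  also have "\<dots> = (\<Sum>u\<in>S. \<Sum>v\<in>T. Y u v * of_bool (g v = d))"
    using t by simp
  also have "\<dots> = (\<Sum>v\<in>T. (\<Sum>u\<in>S. Y u v) * of_bool (g v = d))"
    by (subst sum.swap) (simp add: sum_distrib_right)
  also have "\<dots> = (\<Sum>v\<in>T. of_bool (g v = d))"
    using col by simp
  also have "\<dots> = real (card {v\<in>T. g v = d})"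
    using fin by (simp add: of_bool_def sum.If_cases Int_def)
  finally show ?thesis by simp
qed

text \<open>With \<open>a\<close> and \<open>b\<close> the two degree vectors into the class \<open>d\<close>, intertwining gives
  \<open>a = Y b\<close> and \<open>b = Y\<^sup>T a\<close>, hence \<open>\<Sum>u v. Y u v * (a u - b v)\<^sup>2 = 0\<close>.\<close>

lemma doubly_stochastic_degree_eq:
  fixes Y :: "'a \<Rightarrow> 'b \<Rightarrow> real"
  assumes fin: "finite S" "finite T"
    and row: "\<And>u. u \<in> S \<Longrightarrow> (\<Sum>v\<in>T. Y u v) = 1"
    and col: "\<And>v. v \<in> T \<Longrightarrow> (\<Sum>u\<in>S. Y u v) = 1"
    and nonneg: "\<And>u v. u \<in> S \<Longrightarrow> v \<in> T \<Longrightarrow> 0 \<le> Y u v"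
    and supp: "\<And>u v. u \<in> S \<Longrightarrow> v \<in> T \<Longrightarrow> 0 < Y u v \<Longrightarrow> f u = g v"
    and comm: "\<And>u v. u \<in> S \<Longrightarrow> v \<in> T \<Longrightarrow>
        (\<Sum>u'\<in>S. M u u' * Y u' v) = (\<Sum>v'\<in>T. Y u v' * N v' v)"
    and sym: "\<And>u u'. u \<in> S \<Longrightarrow> u' \<in> S \<Longrightarrow> M u u' = M u' u"
      "\<And>v v'. v \<in> T \<Longrightarrow> v' \<in> T \<Longrightarrow> N v v' = N v' v"
    and uv: "u \<in> S" "v \<in> T" "0 < Y u v"
  shows "(\<Sum>u'\<in>S. M u u' * of_bool (f u' = d)) = (\<Sum>v'\<in>T. N v v' * of_bool (g v' = d))"
proof -
  define a where "a u = (\<Sum>u'\<in>S. M u u' * of_bool (f u' = d))" for u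
  define b where "b v = (\<Sum>v'\<in>T. N v v' * of_bool (g v' = d))" for v
  have t1: "(\<Sum>v\<in>T. Y u v * of_bool (g v = d)) = of_bool (f u = d)" if "u \<in> S" for u
    by (rule weighted_indicator_transport[where S = S]) (use row nonneg supp that in auto)
  have t2: "(\<Sum>u\<in>S. Y u v * of_bool (f u = d)) = of_bool (g v = d)" if "v \<in> T" for v
    by (rule weighted_indicator_transport[where Y = "\<lambda>v u. Y u v" and S = T])
      (use col nonneg supp that in auto)
  \<comment> \<open>Transport rewrites the indicator on \<open>S\<close> as an average over
    \<open>T\<close>; the intertwining relation then moves \<open>Y\<close> past the
    adjacency.\<close>
  have a: "a u = (\<Sum>v\<in>T. Y u v * b v)" if u: "u \<in> S" for u
  proof -
    have "a u = (\<Sum>u'\<in>S. M u u' * (\<Sum>v\<in>T. Y u' v * of_bool (g v = d)))"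
      unfolding a_def using t1 by simp
    also have "\<dots> = (\<Sum>v\<in>T. (\<Sum>u'\<in>S. M u u' * Y u' v) * of_bool (g v = d))"
      unfolding sum_distrib_left sum_distrib_right mult.assoc by (rule sum.swap)
    also have "\<dots> = (\<Sum>v\<in>T. (\<Sum>v'\<in>T. Y u v' * N v' v) * of_bool (g v = d))"
      using comm u by simp
    also have "\<dots> = (\<Sum>v'\<in>T. Y u v' * b v')"
      unfolding b_def sum_distrib_left sum_distrib_right mult.assoc by (rule sum.swap)
    finally show ?thesis .
  qed
  \<comment> \<open>The transposed identity: symmetry of \<open>M\<close> and \<open>N\<close> is
    what transposes the intertwining relation.\<close>
  have b: "b v = (\<Sum>u\<in>S. Y u v * a u)" if v: "v \<in> T" for v
  proof -
    have "b v = (\<Sum>v'\<in>T. N v' v * (\<Sum>u\<in>S. Y u v' * of_bool (f u = d)))"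
      unfolding b_def using t2 sym(2) v by simp
    also have "\<dots> = (\<Sum>v'\<in>T. \<Sum>u\<in>S. (Y u v' * N v' v) * of_bool (f u = d))"
      by (simp add: sum_distrib_left mult_ac)
    also have "\<dots> = (\<Sum>u\<in>S. (\<Sum>v'\<in>T. Y u v' * N v' v) * of_bool (f u = d))"
      unfolding sum_distrib_right by (rule sum.swap)
    also have "\<dots> = (\<Sum>u\<in>S. (\<Sum>u'\<in>S. M u u' * Y u' v) * of_bool (f u = d))"
      using comm v by simp
    also have "\<dots> = (\<Sum>u\<in>S. \<Sum>u'\<in>S. (M u' u * Y u' v) * of_bool (f u = d))"
      unfolding sum_distrib_right using sym(1) by simp
    also have "\<dots> = (\<Sum>u'\<in>S. \<Sum>u\<in>S. (M u' u * Y u' v) * of_bool (f u = d))"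
      by (rule sum.swap)
    also have "\<dots> = (\<Sum>u'\<in>S. Y u' v * a u')"
      by (simp add: a_def sum_distrib_left mult_ac)
    finally show ?thesis .
  qed
  \<comment> \<open>Evaluating the mixed sum in both orders shows that \<open>a\<close> and
    \<open>b\<close> have the same squared length, equal to the mixed sum; the expanded square
    therefore cancels.\<close>
  have cross1: "(\<Sum>u\<in>S. \<Sum>v\<in>T. Y u v * (a u * b v)) = (\<Sum>u\<in>S. (a u)\<^sup>2)"
  proof (intro sum.cong refl)
    fix u assume "u \<in> S"
    then have "(a u)\<^sup>2 = a u * (\<Sum>v\<in>T. Y u v * b v)" using a by (simp add: power2_eq_square)
    then show "(\<Sum>v\<in>T. Y u v * (a u * b v)) = (a u)\<^sup>2" by (simp add: sum_distrib_left mult_ac)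
  qed
  have cross2: "(\<Sum>u\<in>S. \<Sum>v\<in>T. Y u v * (a u * b v)) = (\<Sum>v\<in>T. (b v)\<^sup>2)"
  proof (subst sum.swap, intro sum.cong refl)
    fix v assume "v \<in> T"
    then have "(b v)\<^sup>2 = b v * (\<Sum>u\<in>S. Y u v * a u)" using b by (simp add: power2_eq_square)
    then show "(\<Sum>u\<in>S. Y u v * (a u * b v)) = (b v)\<^sup>2" by (simp add: sum_distrib_left mult_ac)
  qed
  have sq1: "(\<Sum>u\<in>S. \<Sum>v\<in>T. Y u v * (a u)\<^sup>2) = (\<Sum>u\<in>S. (a u)\<^sup>2)"
    using row by (simp flip: sum_distrib_right)
  have sq2: "(\<Sum>u\<in>S. \<Sum>v\<in>T. Y u v * (b v)\<^sup>2) = (\<Sum>v\<in>T. (b v)\<^sup>2)"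
    using col by (subst sum.swap) (simp flip: sum_distrib_right)
  have "(\<Sum>u\<in>S. \<Sum>v\<in>T. Y u v * (a u - b v)\<^sup>2) =
      (\<Sum>u\<in>S. \<Sum>v\<in>T. Y u v * (a u)\<^sup>2 + Y u v * (b v)\<^sup>2 - 2 * (Y u v * (a u * b v)))"
    by (intro sum.cong refl) (simp add: power2_eq_square algebra_simps)
  also have "\<dots> = 0"
    using cross1 cross2
    by (simp add: sum.distrib sum_subtractf sq1 sq2 flip: sum_distrib_left)
  finally have "(\<Sum>u\<in>S. \<Sum>v\<in>T. Y u v * (a u - b v)\<^sup>2) = 0" .
  then have "(\<Sum>v\<in>T. Y u v * (a u - b v)\<^sup>2) = 0"
    using fin nonneg uv(1) by (subst (asm) sum_nonneg_eq_0_iff) (auto intro!: sum_nonneg)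
  then have "Y u v * (a u - b v)\<^sup>2 = 0"
    using fin nonneg uv(1,2) by (subst (asm) sum_nonneg_eq_0_iff) auto
  then show ?thesis using uv(3) by (simp add: a_def b_def)
qed

section \<open>Tuples and replacement of one coordinate\<close>

text \<open>Colours replace cells so that tuples of two different graphs can be compared; a colour
  that is not attained simply has an empty class.\<close>

definition color_class :: "nat \<Rightarrow> ((nat \<Rightarrow> 'n::finite) \<Rightarrow> 'c) \<Rightarrow> 'c \<Rightarrow> (nat \<Rightarrow> 'n) set" where
  "color_class k c d = {u \<in> tuples k. c u = d}"

definition tuple_pairs :: "nat \<Rightarrow> (nat \<Rightarrow> 'n) \<Rightarrow> (nat \<Rightarrow> 'n) \<Rightarrow> ('n \<times> 'n) set" where
  "tuple_pairs k u v = (\<lambda>i. (u i, v i)) ` {1..k}"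

text \<open>With \<open>N\<close> the neighbourhood map or its complement this covers both kinds of
  replacement sets, so that one argument serves both.\<close>

definition replacements :: "('n \<Rightarrow> 'n set) \<Rightarrow> nat \<Rightarrow> (nat \<Rightarrow> 'n) \<Rightarrow> (nat \<Rightarrow> 'n) set" where
  "replacements N i u = {u(i := w) | w. w \<in> N (u i)}"

lemma tuple_nbrs_eq: "tuple_nbrs G i u = replacements (nbrs G) i u"
  by (simp add: tuple_nbrs_def replacements_def)

lemma tuple_nonnbrs_eq: "tuple_nonnbrs G i u = replacements (\<lambda>a. - nbrs G a) i u"
  by (simp add: tuple_nonnbrs_def replacements_def)

lemma finite_tuples [simp]: "finite (tuples k :: (nat \<Rightarrow> 'n::finite) set)"
  by (simp add: tuples_def finite_PiE)

lemma tuple_update [simp]: "u \<in> tuples k \<Longrightarrow> i \<in> {1..k} \<Longrightarrow> u(i := w) \<in> tuples k"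
  by (auto simp: tuples_def PiE_def extensional_def)

lemma tuple_eqI: "u \<in> tuples k \<Longrightarrow> v \<in> tuples k \<Longrightarrow> (\<And>i. i \<in> {1..k} \<Longrightarrow> u i = v i) \<Longrightarrow> u = v"
  unfolding tuples_def by (rule PiE_ext)

lemma card_replacements_color_class:
  assumes "u \<in> tuples k" "i \<in> {1..k}"
  shows "card (replacements N i u \<inter> color_class k c d) = card {w \<in> N (u i). c (u(i := w)) = d}"
proof -
  have "bij_betw (\<lambda>w. u(i := w)) {w \<in> N (u i). c (u(i := w)) = d}
      (replacements N i u \<inter> color_class k c d)"
    using assms
    by (auto simp: bij_betw_def inj_on_def replacements_def color_class_def dest: fun_upd_eqD)
  then show ?thesis by (rule bij_betw_same_card[symmetric])
qed

text \<open>Translates a row of the 0/1 matrix on tuples, the form required by the doubly stochastic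
  lemmas, into a sum over vertices, the form of the linearized equations.\<close>

lemma sum_replacements:
  fixes F :: "(nat \<Rightarrow> 'n::finite) \<Rightarrow> real"
  assumes "u \<in> tuples k" "i \<in> {1..k}"
  shows "(\<Sum>u'\<in>tuples k. of_bool (u' \<in> replacements N i u) * F u') = (\<Sum>w\<in>N (u i). F (u(i := w)))"
proof -
  have "(\<Sum>u'\<in>tuples k. of_bool (u' \<in> replacements N i u) * F u') =
      (\<Sum>u'\<in>tuples k. if u' \<in> replacements N i u then F u' else 0)"
    by (intro sum.cong) auto
  also have "\<dots> = (\<Sum>u'\<in>tuples k \<inter> replacements N i u. F u')"
    by (simp add: sum.inter_restrict)
  also have "tuples k \<inter> replacements N i u = (\<lambda>w. u(i := w)) ` N (u i)"
    using assms by (auto simp: replacements_def)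
  also have "(\<Sum>u'\<in>\<dots>. F u') = (\<Sum>w\<in>N (u i). F (u(i := w)))"
    by (subst sum.reindex) (auto simp: inj_on_def dest: fun_upd_eqD)
  finally show ?thesis .
qed

lemma mem_replacements_commute:
  assumes "\<And>a b. a \<in> N b \<longleftrightarrow> b \<in> N a"
  shows "u \<in> replacements N i v \<longleftrightarrow> v \<in> replacements N i u"
proof -
  have "v \<in> replacements N i u" if u: "u \<in> replacements N i v" for u v
  proof -
    obtain w where w: "w \<in> N (v i)" "u = v(i := w)" using u by (auto simp: replacements_def)
    then have "v = u(i := v i)" "v i \<in> N (u i)" using assms by auto
    then show ?thesis by (auto simp: replacements_def)
  qed
  then show ?thesis by blast
qed

lemma mem_nbrs_commute: "a \<in> nbrs G b \<longleftrightarrow> b \<in> nbrs G a"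
  by (simp add: nbrs_def insert_commute)

lemma card_tuple_pairs: "card (tuple_pairs k u v) \<le> k"
  unfolding tuple_pairs_def by (rule order_trans[OF card_image_le]) auto

text \<open>The pairs at the other coordinates do not depend on \<open>w\<close> and number at most
  \<open>k - 1\<close>; they serve as the set \<open>I\<close> of a linearized equation.\<close>

lemma tuple_pairs_update_left:
  assumes "i \<in> {1..k}"
  shows "tuple_pairs k (u(i := w)) v = insert (w, v i) ((\<lambda>j. (u j, v j)) ` ({1..k} - {i}))"
proof -
  have "tuple_pairs k (u(i := w)) v = (\<lambda>j. ((u(i := w)) j, v j)) ` insert i ({1..k} - {i})"
    unfolding tuple_pairs_def by (simp only: insert_Diff[OF assms])
  also have "\<dots> = insert (w, v i) ((\<lambda>j. ((u(i := w)) j, v j)) ` ({1..k} - {i}))"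
    by (simp only: image_insert fun_upd_same)
  also have "(\<lambda>j. ((u(i := w)) j, v j)) ` ({1..k} - {i}) = (\<lambda>j. (u j, v j)) ` ({1..k} - {i})"
    by (intro image_cong) auto
  finally show ?thesis .
qed

lemma tuple_pairs_update_right:
  assumes "i \<in> {1..k}"
  shows "tuple_pairs k u (v(i := w)) = insert (u i, w) ((\<lambda>j. (u j, v j)) ` ({1..k} - {i}))"
proof -
  have "tuple_pairs k u (v(i := w)) = (\<lambda>j. (u j, (v(i := w)) j)) ` insert i ({1..k} - {i})"
    unfolding tuple_pairs_def by (simp only: insert_Diff[OF assms])
  also have "\<dots> = insert (u i, w) ((\<lambda>j. (u j, (v(i := w)) j)) ` ({1..k} - {i}))"
    by (simp only: image_insert fun_upd_same)
  also have "(\<lambda>j. (u j, (v(i := w)) j)) ` ({1..k} - {i}) = (\<lambda>j. (u j, v j)) ` ({1..k} - {i})"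
    by (intro image_cong) auto
  finally show ?thesis .
qed

lemma card_pairs_remove:
  assumes "i \<in> {1..k}"
  shows "card ((\<lambda>j. (u j, v j)) ` ({1..k} - {i})) \<le> k - 1"
  using assms by (intro order_trans[OF card_image_le]) auto

lemma sum_tuples_Suc:
  fixes F :: "(nat \<Rightarrow> 'n::finite) \<Rightarrow> real"
  shows "(\<Sum>v\<in>tuples (Suc j). F v) = (\<Sum>v\<in>tuples j. \<Sum>w\<in>UNIV. F (v(Suc j := w)))"
proof -
  have "tuples (Suc j) = (\<lambda>(w, v). v(Suc j := w)) ` (UNIV \<times> (tuples j :: (nat \<Rightarrow> 'n) set))"
    unfolding tuples_def by (simp add: atLeastAtMostSuc_conv PiE_insert_eq)
  then have "(\<Sum>v\<in>tuples (Suc j). F v) = (\<Sum>(w, v)\<in>UNIV \<times> tuples j. F (v(Suc j := w)))"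
    using inj_combinator[of "Suc j" "{1..j}" "\<lambda>_. UNIV :: 'n set"]
    by (simp add: sum.reindex tuples_def case_prod_unfold)
  also have "\<dots> = (\<Sum>w\<in>UNIV. \<Sum>v\<in>tuples j. F (v(Suc j := w)))"
    by (simp add: sum.cartesian_product)
  finally show ?thesis by (subst sum.swap)
qed

lemma tuple_pairs_Suc:
  fixes u v :: "nat \<Rightarrow> 'n"
  shows "tuple_pairs (Suc j) u (v(Suc j := w)) = insert (u (Suc j), w) (tuple_pairs j u v)"
  "tuple_pairs (Suc j) (u(Suc j := w)) v = insert (w, v (Suc j)) (tuple_pairs j u v)"
proof -
  have 1: "tuple_pairs (Suc j) u v = insert (u (Suc j), v (Suc j)) (tuple_pairs j u v)" for u v :: "nat \<Rightarrow> 'n"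
    by (simp add: tuple_pairs_def atLeastAtMostSuc_conv)
  have 2: "tuple_pairs j u (v(Suc j := w)) = tuple_pairs j u v"
    "tuple_pairs j (u(Suc j := w)) v = tuple_pairs j u v" for u v :: "nat \<Rightarrow> 'n" and w
    unfolding tuple_pairs_def by (intro image_cong; simp)+
  show "tuple_pairs (Suc j) u (v(Suc j := w)) = insert (u (Suc j), w) (tuple_pairs j u v)"
    "tuple_pairs (Suc j) (u(Suc j := w)) v = insert (w, v (Suc j)) (tuple_pairs j u v)"
    by (simp_all add: 1 2)
qed

section \<open>Support of the tuple matrix of a feasible point\<close>

context
  fixes k :: nat and G H :: "'n::finite set set" and Y :: "('n \<times> 'n) set \<Rightarrow> real"
  assumes rel: "relaxed_iso k G H Y"
begin

text \<open>The first identity is the adjacency equation with \<open>I\<close> the pairs at the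
  other coordinates. The second is its difference from the full sums, which equal \<open>Y I\<close>
  by the column and row equations.\<close>

lemma relaxed_iso_commute:
  assumes i: "i \<in> {1..k}"
  shows "(\<Sum>w\<in>nbrs G (u i). Y (tuple_pairs k (u(i := w)) v)) =
      (\<Sum>w\<in>nbrs H (v i). Y (tuple_pairs k u (v(i := w))))"
    and "(\<Sum>w\<in>- nbrs G (u i). Y (tuple_pairs k (u(i := w)) v)) =
      (\<Sum>w\<in>- nbrs H (v i). Y (tuple_pairs k u (v(i := w))))"
proof -
  let ?I = "(\<lambda>j. (u j, v j)) ` ({1..k} - {i})"
  show 1: "(\<Sum>w\<in>nbrs G (u i). Y (tuple_pairs k (u(i := w)) v)) =
      (\<Sum>w\<in>nbrs H (v i). Y (tuple_pairs k u (v(i := w))))"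
    using rel card_pairs_remove[OF i, of u v]
    unfolding tuple_pairs_update_left[OF i] tuple_pairs_update_right[OF i] relaxed_iso_def by blast
  have "(\<Sum>w\<in>UNIV. Y (tuple_pairs k (u(i := w)) v)) = Y ?I"
    "(\<Sum>w\<in>UNIV. Y (tuple_pairs k u (v(i := w)))) = Y ?I"
    using rel card_pairs_remove[OF i, of u v]
    unfolding tuple_pairs_update_left[OF i] tuple_pairs_update_right[OF i] relaxed_iso_def by blast+
  then show "(\<Sum>w\<in>- nbrs G (u i). Y (tuple_pairs k (u(i := w)) v)) =
      (\<Sum>w\<in>- nbrs H (v i). Y (tuple_pairs k u (v(i := w))))"
    using 1 by (simp add: Compl_eq_Diff_UNIV sum_diff)
qed

lemma relaxed_iso_nonneg: "0 \<le> Y (tuple_pairs k u v)"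
  using rel card_tuple_pairs[of k u v] by (simp add: relaxed_iso_def)

text \<open>The coordinates are summed out one at a time: the last one disappears by a row or column
  equation whose \<open>I\<close> is the set of earlier pairs, and the process ends at
  \<open>Y {} = 1\<close>.\<close>

lemma relaxed_iso_row_col:
  shows relaxed_iso_row: "(\<Sum>v\<in>tuples k. Y (tuple_pairs k u v)) = 1"
    and relaxed_iso_col: "(\<Sum>u\<in>tuples k. Y (tuple_pairs k u v)) = 1"
proof -
  have "(\<Sum>v\<in>tuples j. Y (tuple_pairs j u v)) = 1 \<and> (\<Sum>u\<in>tuples j. Y (tuple_pairs j u v)) = 1"
    if "j \<le> k" for j
    using that
  proof (induction j)
    case 0
    then show ?case using rel by (simp add: tuples_def tuple_pairs_def relaxed_iso_def)
  next
    case (Suc j)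
    have "card (tuple_pairs j u v) \<le> k - 1" for u v :: "nat \<Rightarrow> 'n"
      using card_tuple_pairs[of j u v] Suc.prems by linarith
    then show ?case
      using rel Suc by (simp add: sum_tuples_Suc tuple_pairs_Suc relaxed_iso_def)
  qed
  from this[OF order_refl] show "(\<Sum>v\<in>tuples k. Y (tuple_pairs k u v)) = 1"
    "(\<Sum>u\<in>tuples k. Y (tuple_pairs k u v)) = 1" by blast+
qed

text \<open>\<open>Y\<close> decreases when pairs are added, because
  \<open>Y (insert (a, b) T)\<close> is one nonnegative summand of a row summing to
  \<open>Y T\<close>.\<close>

lemma relaxed_iso_positive_subset:
  assumes "T \<subseteq> tuple_pairs k u v" "0 < Y (tuple_pairs k u v)"
  shows "0 < Y T"
proof -
  have step: "Y (insert (a, b) T) \<le> Y T" if "card (insert (a, b) T) \<le> k" for a b T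
  proof (cases "(a, b) \<in> T")
    case False
    then have c: "card T + 1 \<le> k" using that by simp
    have "0 \<le> Y (insert (a, w) T)" for w
      using rel c by (auto simp: relaxed_iso_def card_insert_if)
    then have "Y (insert (a, b) T) \<le> (\<Sum>w\<in>UNIV. Y (insert (a, w) T))"
      by (intro member_le_sum) auto
    also have "\<dots> = Y T" using rel c by (simp add: relaxed_iso_def)
    finally show ?thesis .
  qed (simp add: insert_absorb)
  have "Y S \<le> Y T" if "finite D" "S = T \<union> D" "card S \<le> k" for S D
    using that
  proof (induction D arbitrary: S)
    case (insert p D)
    have "card (T \<union> D) \<le> k"
      using insert.prems by (intro order_trans[OF card_mono insert.prems(2)]) auto
    then have "Y (T \<union> D) \<le> Y T" by (intro insert.IH) simp
    moreover have "Y S \<le> Y (T \<union> D)"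
      using step[of "fst p" "snd p" "T \<union> D"] insert.prems by simp
    ultimately show ?case by simp
  qed simp
  from this[of "tuple_pairs k u v" "tuple_pairs k u v"] show ?thesis
    using assms card_tuple_pairs[of k u v] by (simp add: Un_absorb1 finite_subset)
qed

text \<open>A positive set of two pairs is a partial isomorphism. In row \<open>c\<close> and column
  \<open>d\<close> of the equations for \<open>I = {(c, d)}\<close>, the summand
  \<open>Y {(c, d)}\<close> exhausts the total, so the others vanish; the adjacency equation then
  decides edges.\<close>

lemma relaxed_iso_entries:
  assumes k: "k \<ge> 2" and pos: "0 < Y {(a, b), (c, d)}"
  shows "a = c \<longleftrightarrow> b = d" "{a, c} \<in> G \<longleftrightarrow> {b, d} \<in> H"
proof -
  have R: "(\<Sum>v\<in>UNIV. Y {(u, v), p}) = Y {p}" "(\<Sum>u\<in>UNIV. Y {(u, v), p}) = Y {p}"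
    "(\<Sum>w\<in>nbrs G u. Y {(w, v), p}) = (\<Sum>w\<in>nbrs H v. Y {(u, w), p})" for u v p
    using rel k by (simp_all add: relaxed_iso_def)
  have nn: "0 \<le> Y {p, q}" for p q
  proof -
    have "card {p, q} \<le> k" using k card_insert_le_m1 by (simp add: card_insert_if)
    then show ?thesis using rel by (simp add: relaxed_iso_def)
  qed
  have zero: "F w = 0" if "(\<Sum>v\<in>UNIV. F v) = F v0" "w \<noteq> v0" "\<And>v. 0 \<le> F v" for F :: "'n \<Rightarrow> real" and v0 w
  proof -
    have "(\<Sum>v\<in>UNIV - {v0}. F v) = 0" using that(1) by (simp add: sum_diff1)
    then show ?thesis using that(2,3) by (subst (asm) sum_nonneg_eq_0_iff) auto
  qed
  have fun1: "Y {(c, w), (c, d)} = 0" if "w \<noteq> d" for w c d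
    using zero[of "\<lambda>v. Y {(c, v), (c, d)}", OF _ that] R(1) nn by simp
  have fun2: "Y {(w, d), (c, d)} = 0" if "w \<noteq> c" for w c d
    using zero[of "\<lambda>v. Y {(v, d), (c, d)}", OF _ that] R(2) nn by simp
  show eq: "a = c \<longleftrightarrow> b = d"
    proof
    assume "a = c"
    then show "b = d" using pos fun1[of b d c] by (cases "b = d") auto
  next
    assume "b = d"
    then show "a = c" using pos fun2[of a c d] by (cases "a = c") auto
  qed
  show "{a, c} \<in> G \<longleftrightarrow> {b, d} \<in> H"
  proof -
    have lhs: "(\<Sum>w\<in>nbrs G a. Y {(w, d), (c, d)}) = (if c \<in> nbrs G a then Y {(c, d)} else 0)"
    proof -
      have "(\<Sum>w\<in>nbrs G a. Y {(w, d), (c, d)}) = (\<Sum>w\<in>nbrs G a. if w = c then Y {(c, d)} else 0)"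
        using fun2 by (intro sum.cong) auto
      then show ?thesis by simp
    qed
    \<comment> \<open>Row \<open>a\<close> distributes \<open>Y {(c, d)}\<close> over neighbours and
      nonneighbours of \<open>d\<close>. By \<open>lhs\<close> the neighbours receive all of it or
      nothing, so one of the two parts vanishes.\<close>
    have split: "(\<Sum>w\<in>nbrs H d. Y {(a, w), (c, d)}) + (\<Sum>w\<in>- nbrs H d. Y {(a, w), (c, d)}) = Y {(c, d)}"
      using R(1)[of a "(c, d)"]
      by (simp add: Compl_eq_Diff_UNIV sum_diff)
    show ?thesis
    proof (cases "c \<in> nbrs G a")
      case True
      then have "(\<Sum>w\<in>- nbrs H d. Y {(a, w), (c, d)}) = 0"
        using lhs R(3) split by simp
      then have "\<forall>w\<in>- nbrs H d. Y {(a, w), (c, d)} = 0"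
        using nn by (subst (asm) sum_nonneg_eq_0_iff) auto
      then have "b \<in> nbrs H d" using pos by (metis ComplI less_irrefl)
      then show ?thesis using True by (simp add: nbrs_def insert_commute)
    next
      case False
      then have "(\<Sum>w\<in>nbrs H d. Y {(a, w), (c, d)}) = 0"
        using lhs R(3) by simp
      then have "\<forall>w\<in>nbrs H d. Y {(a, w), (c, d)} = 0"
        using nn by (subst (asm) sum_nonneg_eq_0_iff) auto
      then have "b \<notin> nbrs H d" using pos by (metis less_irrefl)
      then show ?thesis using False by (simp add: nbrs_def insert_commute)
    qed
  qed
qed

text \<open>Diagonal entries are 0 in any graph; an off-diagonal entry involves two coordinates,
  which supplies \<open>k \<ge> 2\<close> and a positive set of two pairs.\<close>

lemma relaxed_iso_comb_matrix:
  assumes pos: "0 < Y (tuple_pairs k u v)"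
  shows "comb_matrix k G u = comb_matrix k H v"
proof -
  have "comb_entry G u i j = comb_entry H v i j" if ij: "i \<in> {1..k}" "j \<in> {1..k}" for i j
  proof (cases "i = j")
    case False
    then have "k \<ge> 2" using ij by auto
    moreover have "0 < Y {(u i, v i), (u j, v j)}"
      using ij by (intro relaxed_iso_positive_subset[OF _ pos]) (auto simp: tuple_pairs_def)
    ultimately show ?thesis
      using relaxed_iso_entries[of "u i" "v i" "u j" "v j"] by (simp add: comb_entry_def)
  qed (simp add: comb_entry_def)
  then show ?thesis unfolding comb_matrix_def by (auto intro!: map_cong)
qed

context
  fixes cG cH :: "(nat \<Rightarrow> 'n) \<Rightarrow> 'c"
  assumes supp: "\<And>u v. u \<in> tuples k \<Longrightarrow> v \<in> tuples k \<Longrightarrow> 0 < Y (tuple_pairs k u v) \<Longrightarrow> cG u = cH v"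
begin

lemma relaxed_iso_class_card: "card (color_class k cG d) = card (color_class k cH d)"
  unfolding color_class_def
  by (rule doubly_stochastic_class_card[where Y = "\<lambda>u v. Y (tuple_pairs k u v)"])
    (auto simp: relaxed_iso_row relaxed_iso_col relaxed_iso_nonneg supp)

text \<open>The replacement relations in direction \<open>i\<close> are symmetric 0/1 matrices on
  tuples, intertwined by \<open>Y\<close>, so the degrees into matching classes agree along the
  support of \<open>Y\<close>.\<close>

lemma relaxed_iso_degree_aux:
  assumes i: "i \<in> {1..k}" and u: "u \<in> tuples k" and v: "v \<in> tuples k"
    and pos: "0 < Y (tuple_pairs k u v)"
    and sym: "\<And>a b. a \<in> M b \<longleftrightarrow> b \<in> M a" "\<And>a b. a \<in> N b \<longleftrightarrow> b \<in> N a"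
    and comm: "\<And>u v. (\<Sum>w\<in>M (u i). Y (tuple_pairs k (u(i := w)) v)) =
      (\<Sum>w\<in>N (v i). Y (tuple_pairs k u (v(i := w))))"
  shows "card (replacements M i u \<inter> color_class k cG d) = card (replacements N i v \<inter> color_class k cH d)"
proof -
  have "(\<Sum>u'\<in>tuples k. of_bool (u' \<in> replacements M i u) * of_bool (cG u' = d) :: real) =
      (\<Sum>v'\<in>tuples k. of_bool (v' \<in> replacements N i v) * of_bool (cH v' = d))"
  proof (rule doubly_stochastic_degree_eq[where Y = "\<lambda>u v. Y (tuple_pairs k u v)" and
        M = "\<lambda>u u'. of_bool (u' \<in> replacements M i u)" and
        N = "\<lambda>v v'. of_bool (v' \<in> replacements N i v)"])
    fix u v :: "nat \<Rightarrow> 'n" assume "u \<in> tuples k" "v \<in> tuples k"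
    then show "(\<Sum>u'\<in>tuples k. of_bool (u' \<in> replacements M i u) * Y (tuple_pairs k u' v)) =
        (\<Sum>v'\<in>tuples k. Y (tuple_pairs k u v') * of_bool (v \<in> replacements N i v'))"
      using comm[of u v] sum_replacements[OF _ i, of u M "\<lambda>u'. Y (tuple_pairs k u' v)"]
        sum_replacements[OF _ i, of v N "\<lambda>v'. Y (tuple_pairs k u v')"]
      by (subst mem_replacements_commute[OF sym(2)]) (simp only: mult.commute)
  next
    show "of_bool (u' \<in> replacements M i u) = (of_bool (u \<in> replacements M i u') :: real)" for u u'
      by (subst mem_replacements_commute[OF sym(1)]) simp
    show "of_bool (u' \<in> replacements N i u) = (of_bool (u \<in> replacements N i u') :: real)" for u u'
      by (subst mem_replacements_commute[OF sym(2)]) simp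
  qed (use u v pos supp in \<open>auto simp: relaxed_iso_row relaxed_iso_col relaxed_iso_nonneg\<close>)
  then have "(\<Sum>w\<in>M (u i). of_bool (cG (u(i := w)) = d) :: real) =
      (\<Sum>w\<in>N (v i). of_bool (cH (v(i := w)) = d))"
    by (simp only: sum_replacements[OF u i] sum_replacements[OF v i])
  then show ?thesis
    unfolding card_replacements_color_class[OF u i] card_replacements_color_class[OF v i]
    by (simp add: of_bool_def sum.If_cases Int_def)
qed

lemma relaxed_iso_degree:
  assumes i: "i \<in> {1..k}" and u: "u \<in> tuples k" and v: "v \<in> tuples k"
    and pos: "0 < Y (tuple_pairs k u v)"
  shows "card (tuple_nbrs G i u \<inter> color_class k cG d) = card (tuple_nbrs H i v \<inter> color_class k cH d)"
    and "card (tuple_nonnbrs G i u \<inter> color_class k cG d) = card (tuple_nonnbrs H i v \<inter> color_class k cH d)"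
  unfolding tuple_nbrs_eq tuple_nonnbrs_eq
  by (rule relaxed_iso_degree_aux[OF i u v pos]; use relaxed_iso_commute[OF i] in \<open>simp add: mem_nbrs_commute\<close>)+

end

end

section \<open>Feasible points from stable colourings\<close>

lemma tuple_compose:
  assumes "u \<in> tuples k" "\<And>i. i \<in> {1..k} \<Longrightarrow> f i \<in> {1..k}" "\<And>i. i \<notin> {1..k} \<Longrightarrow> f i = i"
  shows "u \<circ> f \<in> tuples k"
  using assms by (auto simp: tuples_def PiE_def extensional_def)

lemma tuple_permute: "u \<in> tuples k \<Longrightarrow> \<sigma> permutes {1..k} \<Longrightarrow> u \<circ> \<sigma> \<in> tuples k"
  by (erule tuple_compose) (simp_all add: permutes_in_image permutes_not_in del: atLeastAtMost_iff)

text \<open>Generation also admits inverses of generators, about which the hypotheses on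
  \<open>R\<close> say nothing directly; in a finite group an inverse is a power.\<close>

lemma generates_sym_closed:
  assumes gen: "generates_sym k \<sigma>1 \<sigma>2"
    and R1: "\<And>u v. u \<in> tuples k \<Longrightarrow> v \<in> tuples k \<Longrightarrow> R u v \<Longrightarrow> R (u \<circ> \<sigma>1) (v \<circ> \<sigma>1)"
    and R2: "\<And>u v. u \<in> tuples k \<Longrightarrow> v \<in> tuples k \<Longrightarrow> R u v \<Longrightarrow> R (u \<circ> \<sigma>2) (v \<circ> \<sigma>2)"
    and \<tau>: "\<tau> permutes {1..k}"
    and uv: "u \<in> tuples k" "v \<in> tuples k" "R u v"
  shows "R (u \<circ> \<tau>) (v \<circ> \<tau>)"
proof -
  have perm: "\<sigma>1 permutes {1..k}" "\<sigma>2 permutes {1..k}"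
    and "generate (sym_group k) {\<sigma>1, \<sigma>2} = carrier (sym_group k)"
    using gen by (auto simp: generates_sym_def)
  then have "\<tau> \<in> generate (sym_group k) {\<sigma>1, \<sigma>2}"
    using \<tau> by (simp add: sym_group_carrier)
  then have "\<tau> permutes {1..k} \<and>
      (\<forall>u\<in>tuples k. \<forall>v\<in>tuples k. R u v \<longrightarrow> R (u \<circ> \<tau>) (v \<circ> \<tau>))"
  proof (induction \<tau>)
    case one
    show ?case unfolding sym_group_one comp_id using permutes_id by blast
  next
    case (incl h)
    then show ?case using perm R1 R2 by blast
  next
    case (inv h)
    then have h: "h permutes {1..k}" using perm by blast
    have step: "R (u \<circ> h) (v \<circ> h)" if "u \<in> tuples k" "v \<in> tuples k" "R u v" for u v
      using inv that R1 R2 by blast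
    have pow: "(h ^^ m) permutes {1..k} \<and>
        (\<forall>u\<in>tuples k. \<forall>v\<in>tuples k. R u v \<longrightarrow> R (u \<circ> (h ^^ m)) (v \<circ> (h ^^ m)))" for m
    proof (induction m)
      case 0
      show ?case unfolding funpow.simps(1) comp_id using permutes_id by blast
    next
      case (Suc m)
      have "R (u \<circ> (h ^^ Suc m)) (v \<circ> (h ^^ Suc m))" if "u \<in> tuples k" "v \<in> tuples k" "R u v" for u v
        unfolding funpow_Suc_right o_assoc using Suc that
        by (intro step tuple_permute) blast+
      moreover have "(h ^^ Suc m) permutes {1..k}"
        unfolding funpow.simps using Suc h permutes_compose by blast
      ultimately show ?case by blast
    qed
    \<comment> \<open>The finite order \<open>n\<close> of \<open>h\<close> makes
      \<open>h ^^ (n - 1)\<close> its inverse; positivity of \<open>n\<close> keeps the exponent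
      meaningful.\<close>
    obtain n where n: "h ^^ n = id" "n > 0"
      using h permutation_is_nilpotent permutation_permutes by blast
    then have "h ^^ (n - 1) \<circ> h = id"
      by (metis Suc_diff_1 funpow_Suc_right)
    moreover have "h \<circ> h ^^ (n - 1) = id"
      using n by (metis Suc_diff_1 funpow.simps(2))
    ultimately have "inv' h = h ^^ (n - 1)"
      by (intro inv_unique_comp)
    moreover have "inv\<^bsub>sym_group k\<^esub> h = inv' h"
      using h by (simp add: sym_group_carrier)
    ultimately have eq: "inv\<^bsub>sym_group k\<^esub> h = h ^^ (n - 1)" by (simp only:)
    show ?case unfolding eq by (rule pow)
  next
    case (eng h1 h2)
    have "R (u \<circ> (h1 \<circ> h2)) (v \<circ> (h1 \<circ> h2))" if "u \<in> tuples k" "v \<in> tuples k" "R u v" for u v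
    proof -
      have "u \<circ> h1 \<in> tuples k" "v \<circ> h1 \<in> tuples k" "R (u \<circ> h1) (v \<circ> h1)"
        using eng that tuple_permute by blast+
      then show ?thesis using eng.IH(2) unfolding o_assoc by blast
    qed
    moreover have "h1 \<circ> h2 permutes {1..k}" using eng permutes_compose by blast
    ultimately show ?case unfolding sym_group_mult by blast
  qed
  then show ?thesis using uv by blast
qed

section \<open>Closure properties of a stable pair of colourings\<close>

text \<open>\<open>cG u = cH v\<close> stands in for the existence of an isomorphism mapping
  \<open>u\<close> to \<open>v\<close>. Both versions of the algorithm supply such a pair, the
  automorphism version with \<open>G = H\<close> and a single colouring.\<close>

locale stable_pair =
  fixes k :: nat and G H :: "'n::finite set set" and cG cH :: "(nat \<Rightarrow> 'n) \<Rightarrow> 'c"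
  assumes k_pos: "k \<ge> 1"
    and permute: "\<And>u v \<tau>. u \<in> tuples k \<Longrightarrow> v \<in> tuples k \<Longrightarrow> cG u = cH v \<Longrightarrow> \<tau> permutes {1..k} \<Longrightarrow>
      cG (u \<circ> \<tau>) = cH (v \<circ> \<tau>)"
    and comb: "\<And>u v i j. u \<in> tuples k \<Longrightarrow> v \<in> tuples k \<Longrightarrow> cG u = cH v \<Longrightarrow>
      i \<in> {1..k} \<Longrightarrow> j \<in> {1..k} \<Longrightarrow> comb_entry G u i j = comb_entry H v i j"
    and nbrs_card: "\<And>u v i d. u \<in> tuples k \<Longrightarrow> v \<in> tuples k \<Longrightarrow> cG u = cH v \<Longrightarrow> i \<in> {1..k} \<Longrightarrow>
      card (tuple_nbrs G i u \<inter> color_class k cG d) = card (tuple_nbrs H i v \<inter> color_class k cH d)"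
    and nonnbrs_card: "\<And>u v i d. u \<in> tuples k \<Longrightarrow> v \<in> tuples k \<Longrightarrow> cG u = cH v \<Longrightarrow> i \<in> {1..k} \<Longrightarrow>
      card (tuple_nonnbrs G i u \<inter> color_class k cG d) =
      card (tuple_nonnbrs H i v \<inter> color_class k cH d)"
    and class_card: "\<And>d. card (color_class k cG d) = card (color_class k cH d)"
begin

lemma swap: "stable_pair k H G cH cG"
proof unfold_locales
  fix u v :: "nat \<Rightarrow> 'n" assume uv: "u \<in> tuples k" "v \<in> tuples k" "cH u = cG v"
  note vu = uv(2,1) uv(3)[symmetric]
  show "cH (u \<circ> \<tau>) = cG (v \<circ> \<tau>)" if "\<tau> permutes {1..k}" for \<tau>
    using permute[OF vu that] by simp
  show "comb_entry H u i j = comb_entry G v i j" if "i \<in> {1..k}" "j \<in> {1..k}" for i j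
    using comb[OF vu that] by simp
  show "card (tuple_nbrs H i u \<inter> color_class k cH d) = card (tuple_nbrs G i v \<inter> color_class k cG d)"
    if "i \<in> {1..k}" for i d
    using nbrs_card[OF vu that] by simp
  show "card (tuple_nonnbrs H i u \<inter> color_class k cH d) = card (tuple_nonnbrs G i v \<inter> color_class k cG d)"
    if "i \<in> {1..k}" for i d
    using nonnbrs_card[OF vu that] by simp
qed (simp_all only: k_pos class_card)

lemma ex_partner: "u \<in> tuples k \<Longrightarrow> \<exists>v\<in>tuples k. cG u = cH v"
proof -
  assume "u \<in> tuples k"
  then have "u \<in> color_class k cG (cG u)" by (simp add: color_class_def)
  then have "card (color_class k cG (cG u)) \<noteq> 0" by (auto simp: color_class_def)
  then have "color_class k cH (cG u) \<noteq> {}" unfolding class_card by force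
  then show ?thesis by (force simp: color_class_def)
qed

text \<open>Two equally coloured tuples of \<open>G\<close> are compared through a common partner in
  \<open>H\<close>, which exists because matching classes have the same size.\<close>

lemma self: "stable_pair k G G cG cG"
proof unfold_locales
  fix u v :: "nat \<Rightarrow> 'n" assume u: "u \<in> tuples k" and v: "v \<in> tuples k" and eq: "cG u = cG v"
  obtain w where w: "w \<in> tuples k" "cG u = cH w" "cG v = cH w" using ex_partner[OF u] eq by auto
  show "cG (u \<circ> \<tau>) = cG (v \<circ> \<tau>)" if "\<tau> permutes {1..k}" for \<tau>
    using permute[OF u w(1,2) that] permute[OF v w(1,3) that] by simp
  show "comb_entry G u i j = comb_entry G v i j" if "i \<in> {1..k}" "j \<in> {1..k}" for i j
    using comb[OF u w(1,2) that] comb[OF v w(1,3) that] by simp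
  show "card (tuple_nbrs G i u \<inter> color_class k cG d) = card (tuple_nbrs G i v \<inter> color_class k cG d)"
    if "i \<in> {1..k}" for i d
    using nbrs_card[OF u w(1,2) that] nbrs_card[OF v w(1,3) that] by simp
  show "card (tuple_nonnbrs G i u \<inter> color_class k cG d) = card (tuple_nonnbrs G i v \<inter> color_class k cG d)"
    if "i \<in> {1..k}" for i d
    using nonnbrs_card[OF u w(1,2) that] nonnbrs_card[OF v w(1,3) that] by simp
qed (simp_all only: k_pos)

lemma coord_eq_iff:
  assumes "u \<in> tuples k" "v \<in> tuples k" "cG u = cH v" "i \<in> {1..k}" "j \<in> {1..k}"
  shows "u i = u j \<longleftrightarrow> v i = v j"
  using comb[OF assms] by (auto simp: comb_entry_def split: if_splits)

text \<open>Neighbours and nonneighbours together exhaust all replacements of a coordinate.\<close>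

lemma update_card:
  assumes uv: "u \<in> tuples k" "v \<in> tuples k" "cG u = cH v" and i: "i \<in> {1..k}"
  shows "card {w. cG (u(i := w)) = d} = card {w. cH (v(i := w)) = d}"
proof -
  have split: "card {w. Q w} = card {w \<in> N. Q w} + card {w \<in> - N. Q w}" for Q and N :: "'n set"
    by (subst card_Un_disjoint[symmetric]) (auto intro!: arg_cong[where f = card])
  show ?thesis
    using nbrs_card[OF uv i, of d] nonnbrs_card[OF uv i, of d]
    unfolding tuple_nbrs_eq tuple_nonnbrs_eq card_replacements_color_class[OF uv(1) i]
      card_replacements_color_class[OF uv(2) i]
      split[of "\<lambda>w. cG (u(i := w)) = d" "nbrs G (u i)"] split[of "\<lambda>w. cH (v(i := w)) = d" "nbrs H (v i)"]
    by (rule arg_cong2)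
qed

text \<open>Equal counts yield some \<open>w\<close> such that \<open>v(i := w)\<close> has the
  colour of \<open>u(i := u j)\<close>. Colours determine which coordinates coincide, and this
  forces \<open>w = v j\<close>.\<close>

lemma copy_coord:
  assumes uv: "u \<in> tuples k" "v \<in> tuples k" "cG u = cH v" and i: "i \<in> {1..k}" and j: "j \<in> {1..k}"
  shows "cG (u(i := u j)) = cH (v(i := v j))"
proof (cases "i = j")
  case False
  let ?d = "cG (u(i := u j))"
  have "u j \<in> {w. cG (u(i := w)) = ?d}" by simp
  then have "card {w. cG (u(i := w)) = ?d} \<noteq> 0" by (subst card_0_eq) (simp, blast)
  then have "{w. cH (v(i := w)) = ?d} \<noteq> {}"
    unfolding update_card[OF uv i] by force
  then obtain w where w: "?d = cH (v(i := w))" by (metis (mono_tags) Collect_empty_eq)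
  have "(v(i := w)) i = (v(i := w)) j"
    using coord_eq_iff[OF _ _ w i j] uv i False by simp
  then show ?thesis using w False by simp
qed (use uv in simp)

text \<open>A noninjective \<open>f\<close> is a map with larger range followed by copying one coordinate to another.\<close>

lemma compose:
  assumes uv: "u \<in> tuples k" "v \<in> tuples k" "cG u = cH v"
    and f: "\<And>i. i \<in> {1..k} \<Longrightarrow> f i \<in> {1..k}" "\<And>i. i \<notin> {1..k} \<Longrightarrow> f i = i"
  shows "cG (u \<circ> f) = cH (v \<circ> f)"
  using f
proof (induction "k - card (f ` {1..k})" arbitrary: f rule: less_induct)
  case less
  show ?case
  proof (cases "inj_on f {1..k}")
    case True
    have "f ` {1..k} \<subseteq> {1..k}" using less.prems(1) by blast
    with True have "bij_betw f {1..k} {1..k}"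
      by (simp add: bij_betw_def endo_inj_surj)
    then have "f permutes {1..k}" using less.prems(2) by (rule bij_imp_permutes)
    then show ?thesis by (rule permute[OF uv])
  next
    case False
    then obtain i j where ij: "i \<in> {1..k}" "j \<in> {1..k}" "i \<noteq> j" "f i = f j"
      by (auto simp: inj_on_def)
    have sub: "f ` {1..k} \<subseteq> {1..k}" using less.prems(1) by blast
    have "card (f ` {1..k}) \<noteq> card {1..k}" using False by (simp add: inj_on_iff_eq_card)
    then have "f ` {1..k} \<noteq> {1..k}" by auto
    then obtain m where m: "m \<in> {1..k}" "m \<notin> f ` {1..k}" using sub by blast
    let ?f = "f(i := m)"
    \<comment> \<open>Overwriting \<open>f\<close> at \<open>i\<close> loses no value, since
      \<open>j\<close> still attains \<open>f i\<close>, and it gains \<open>m\<close>; hence the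
      range grows.\<close>
    have "insert m (f ` {1..k}) \<subseteq> ?f ` {1..k}"
    proof
      fix x assume "x \<in> insert m (f ` {1..k})"
      then consider "x = m" | l where "l \<in> {1..k}" "x = f l" by blast
      then show "x \<in> ?f ` {1..k}"
      proof cases
        case 1
        then show ?thesis using ij(1) by (intro image_eqI[where x = i]) simp_all
      next
        case 2
        then show ?thesis using ij by (intro image_eqI[where x = "if l = i then j else l"]) auto
      qed
    qed
    then have "card (insert m (f ` {1..k})) \<le> card (?f ` {1..k})" by (intro card_mono) auto
    then have "card (f ` {1..k}) < card (?f ` {1..k})" using m(2) by simp
    moreover have "card (?f ` {1..k}) \<le> k" by (rule order_trans[OF card_image_le]) auto
    ultimately have "k - card (?f ` {1..k}) < k - card (f ` {1..k})" by linarith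
    then have IH: "cG (u \<circ> ?f) = cH (v \<circ> ?f)"
      using less.prems m(1) ij(1) by (intro less.hyps) auto
    have T: "u \<circ> ?f \<in> tuples k" "v \<circ> ?f \<in> tuples k"
      using less.prems m(1) ij(1) uv by (auto intro!: tuple_compose)
    have "(x \<circ> ?f)(i := (x \<circ> ?f) j) = x \<circ> f" for x :: "nat \<Rightarrow> 'n"
      using ij by auto
    then show ?thesis using copy_coord[OF T IH ij(1,2)] by simp
  qed
qed

end

section \<open>The weight matrix of a stable pair\<close>

text \<open>For a stable pair, row \<open>u\<close> is the uniform distribution on the tuples of
  \<open>H\<close> with the colour of \<open>u\<close>, because matching classes have equal
  size.\<close>

definition color_weight ::
    "nat \<Rightarrow> ((nat \<Rightarrow> 'n::finite) \<Rightarrow> 'c) \<Rightarrow> ((nat \<Rightarrow> 'n) \<Rightarrow> 'c) \<Rightarrow> (nat \<Rightarrow> 'n) \<Rightarrow> (nat \<Rightarrow> 'n) \<Rightarrow> real" where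
  "color_weight k cG cH u v =
     (if cG u = cH v then 1 / real (card (color_class k cG (cG u))) else 0)"

lemma finite_color_class [simp]: "finite (color_class k c d)"
  by (simp add: color_class_def)

lemma card_color_class_pos: "u \<in> tuples k \<Longrightarrow> 0 < card (color_class k c (c u))"
  by (auto simp: card_gt_0_iff color_class_def)

text \<open>Each pair on the left occurs at some index on the right, and \<open>f\<close> selects
  one. It is the identity outside \<open>{1..k}\<close> so that composition preserves
  extensionality.\<close>

lemma tuple_pairs_subset_compose:
  assumes "tuple_pairs k u' v' \<subseteq> tuple_pairs k u v"
    and T: "u \<in> tuples k" "v \<in> tuples k" "u' \<in> tuples k" "v' \<in> tuples k"
  obtains f where "\<And>i. i \<in> {1..k} \<Longrightarrow> f i \<in> {1..k}" "\<And>i. i \<notin> {1..k} \<Longrightarrow> f i = i"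
    "u' = u \<circ> f" "v' = v \<circ> f"
proof -
  have "\<forall>i\<in>{1..k}. \<exists>j\<in>{1..k}. u' i = u j \<and> v' i = v j"
    using assms(1) by (auto simp: tuple_pairs_def image_iff subset_eq)
  then obtain g where g: "\<And>i. i \<in> {1..k} \<Longrightarrow> g i \<in> {1..k} \<and> u' i = u (g i) \<and> v' i = v (g i)"
    by metis
  let ?f = "\<lambda>i. if i \<in> {1..k} then g i else i"
  have f: "\<And>i. i \<in> {1..k} \<Longrightarrow> ?f i \<in> {1..k}" "\<And>i. i \<notin> {1..k} \<Longrightarrow> ?f i = i"
    using g by auto
  moreover have "u' = u \<circ> ?f" "v' = v \<circ> ?f"
    by (rule tuple_eqI[OF _ tuple_compose[OF _ f]]; use g T in simp)+
  ultimately show ?thesis by (rule that)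
qed

context stable_pair
begin

text \<open>Composition with \<open>f\<close> sends the class of \<open>u\<close> into that of
  \<open>u'\<close>. It is injective there: \<open>g\<close> undoes \<open>f\<close> on
  \<open>u\<close>, and tuples of one colour share the same coincidences of coordinates, so
  \<open>g\<close> undoes it on the whole class.\<close>

lemma class_card_mono:
  assumes sub: "tuple_pairs k u v \<subseteq> tuple_pairs k u' v'" "tuple_pairs k u' v' \<subseteq> tuple_pairs k u v"
    and T: "u \<in> tuples k" "v \<in> tuples k" "u' \<in> tuples k" "v' \<in> tuples k"
  shows "card (color_class k cG (cG u)) \<le> card (color_class k cG (cG u'))"
proof -
  obtain f where f: "\<And>i. i \<in> {1..k} \<Longrightarrow> f i \<in> {1..k}" "\<And>i. i \<notin> {1..k} \<Longrightarrow> f i = i" "u' = u \<circ> f"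
    using tuple_pairs_subset_compose[OF sub(2) T] by metis
  obtain g where g: "\<And>i. i \<in> {1..k} \<Longrightarrow> g i \<in> {1..k}" "u = u' \<circ> g"
    using tuple_pairs_subset_compose[OF sub(1) T(3,4,1,2)] by metis
  have inv: "x (f (g i)) = x i" if x: "x \<in> tuples k" "cG x = cG u" and i: "i \<in> {1..k}" for x i
  proof -
    have "u (f (g i)) = u i" using f(3) g(2) by (metis comp_apply)
    then show ?thesis
      using stable_pair.coord_eq_iff[OF self x(1) T(1) x(2)] f(1)[OF g(1)[OF i]] i by blast
  qed
  show ?thesis
  proof (rule card_inj_on_le[where f = "\<lambda>x. x \<circ> f"])
    show "inj_on (\<lambda>x. x \<circ> f) (color_class k cG (cG u))"
    proof (rule inj_onI)
      fix x y assume xy: "x \<in> color_class k cG (cG u)" "y \<in> color_class k cG (cG u)" "x \<circ> f = y \<circ> f"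
      show "x = y"
      proof (rule tuple_eqI)
        fix i assume i: "i \<in> {1..k}"
        have "x (f (g i)) = y (f (g i))" using xy(3) by (metis comp_apply)
        then show "x i = y i"
          using inv[of x, OF _ _ i] inv[of y, OF _ _ i] xy(1,2) by (simp add: color_class_def)
      qed (use xy in \<open>simp_all add: color_class_def\<close>)
    qed
    show "(\<lambda>x. x \<circ> f) ` color_class k cG (cG u) \<subseteq> color_class k cG (cG u')"
      using stable_pair.compose[OF self _ T(1) _ f(1,2)] tuple_compose[OF _ f(1,2)]
      by (auto simp: color_class_def f(3))
  qed simp
qed

text \<open>This makes the weight well defined on sets of pairs: reindexing transfers equality of
  colours, and the class sizes agree by two inequalities.\<close>

lemma color_weight_cong:
  assumes eq: "tuple_pairs k u v = tuple_pairs k u' v'"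
    and T: "u \<in> tuples k" "v \<in> tuples k" "u' \<in> tuples k" "v' \<in> tuples k"
  shows "color_weight k cG cH u v = color_weight k cG cH u' v'"
proof -
  have "cG u' = cH v'" if "cG u = cH v" "tuple_pairs k u v = tuple_pairs k u' v'"
    "u \<in> tuples k" "v \<in> tuples k" "u' \<in> tuples k" "v' \<in> tuples k" for u v u' v'
    using tuple_pairs_subset_compose[OF eq_refl[OF that(2)[symmetric]] that(3-)] compose[OF that(3,4,1)]
    by metis
  then have "cG u = cH v \<longleftrightarrow> cG u' = cH v'" using assms by metis
  moreover have "card (color_class k cG (cG u)) = card (color_class k cG (cG u'))"
    using class_card_mono[of u v u' v'] class_card_mono[of u' v' u v] eq T by simp
  ultimately show ?thesis by (simp add: color_weight_def)
qed

lemma color_weight_swap: "color_weight k cH cG v u = color_weight k cG cH u v"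
  by (simp add: color_weight_def class_card)

text \<open>The repeated last coordinate is the free place. Copying coordinate 1 into it maps the
  \<open>H\<close>-class coloured like \<open>u(k := a)\<close> onto the one coloured like
  \<open>u\<close>, with all fibres of size \<open>?m\<close>; so the class sizes differ by the
  factor \<open>?m\<close>, which counts the nonzero summands.\<close>

lemma color_weight_row:
  assumes k: "k \<ge> 2" and T: "u \<in> tuples k" "v \<in> tuples k" and last: "u k = u 1" "v k = v 1"
  shows "(\<Sum>b\<in>UNIV. color_weight k cG cH (u(k := a)) (v(k := b))) = color_weight k cG cH u v"
proof -
  have kk: "k \<in> {1..k}" "1 \<in> {1..k}" "1 \<noteq> k" using k by auto
  let ?d = "cG (u(k := a))"
  let ?m = "card {b. cH (v(k := b)) = ?d}"
  have upd: "x(k := x 1, k := y) = x(k := y)" for x :: "nat \<Rightarrow> 'n" and y by simp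
  \<comment> \<open>Copying coordinate 1 into \<open>k\<close> turns \<open>u(k := a)\<close> back
    into \<open>u\<close>, because \<open>u k = u 1\<close>.\<close>
  have copy: "cG u = cH (x(k := x 1))" if "x \<in> color_class k cH ?d" for x
    using copy_coord[of "u(k := a)" x k 1] that kk T(1) last(1)
    by (simp add: color_class_def fun_upd_idem)
  have sum: "(\<Sum>b\<in>UNIV. color_weight k cG cH (u(k := a)) (v(k := b))) =
      real ?m / real (card (color_class k cG ?d))"
  proof -
    have "(\<Sum>b\<in>UNIV. color_weight k cG cH (u(k := a)) (v(k := b))) =
        (\<Sum>b\<in>UNIV. if cH (v(k := b)) = ?d then 1 / real (card (color_class k cG ?d)) else 0)"
      by (intro sum.cong) (auto simp: color_weight_def)
    then show ?thesis by (simp add: sum.If_cases)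
  qed
  show ?thesis
  proof (cases "cG u = cH v")
    case True
    have "card (color_class k cH ?d) = (\<Sum>z\<in>color_class k cH (cG u). ?m)"
    proof -
      have "card (color_class k cH ?d) =
          (\<Sum>z\<in>color_class k cH (cG u). card {x \<in> color_class k cH ?d. x(k := x 1) = z})"
        unfolding card_eq_sum
        by (rule sum.group[symmetric]) (use copy kk in \<open>auto simp: color_class_def simp del: One_nat_def\<close>)
      also have "\<dots> = (\<Sum>z\<in>color_class k cH (cG u). ?m)"
      proof (intro sum.cong refl)
        fix z assume z: "z \<in> color_class k cH (cG u)"
        then have zT: "z \<in> tuples k" and zc: "cG u = cH z" by (auto simp: color_class_def)
        have zl: "z k = z 1" using coord_eq_iff[OF T(1) zT zc kk(1,2)] last by simp
        have "bij_betw (\<lambda>b. z(k := b)) {b. cH (z(k := b)) = ?d}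
            {x \<in> color_class k cH ?d. x(k := x 1) = z}"
          unfolding bij_betw_def
        proof
          show "inj_on (\<lambda>b. z(k := b)) {b. cH (z(k := b)) = ?d}"
            by (auto simp: inj_on_def dest: fun_upd_eqD)
          show "(\<lambda>b. z(k := b)) ` {b. cH (z(k := b)) = ?d} = {x \<in> color_class k cH ?d. x(k := x 1) = z}"
          proof (intro equalityI subsetI)
            fix x assume "x \<in> (\<lambda>b. z(k := b)) ` {b. cH (z(k := b)) = ?d}"
            then show "x \<in> {x \<in> color_class k cH ?d. x(k := x 1) = z}"
              using zT kk zl by (auto simp: color_class_def fun_upd_idem)
          next
            fix x assume x: "x \<in> {x \<in> color_class k cH ?d. x(k := x 1) = z}"
            then have "x = z(k := x k)" by auto
            then show "x \<in> (\<lambda>b. z(k := b)) ` {b. cH (z(k := b)) = ?d}"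
              using x by (intro image_eqI[where x = "x k"]) (auto simp: color_class_def)
          qed
        qed
        then have "card {x \<in> color_class k cH ?d. x(k := x 1) = z} = card {b. cH (z(k := b)) = ?d}"
          by (simp add: bij_betw_same_card)
        \<comment> \<open>The fibre size passes from \<open>z\<close> to \<open>u\<close> and then
          to \<open>v\<close>; all three have the same colour.\<close>
        also have "\<dots> = card {b. cG (u(k := b)) = ?d}"
          by (rule update_card[OF T(1) zT zc kk(1), symmetric])
        also have "\<dots> = ?m" by (rule update_card[OF T True kk(1)])
        finally show "card {x \<in> color_class k cH ?d. x(k := x 1) = z} = ?m" .
      qed
      finally show ?thesis .
    qed
    then have "card (color_class k cG ?d) = card (color_class k cG (cG u)) * ?m"
      by (simp add: class_card)
    then have "real (card (color_class k cG ?d)) = real (card (color_class k cG (cG u))) * real ?m"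
      by simp
    moreover have nz: "real (card (color_class k cG ?d)) \<noteq> 0" "real (card (color_class k cG (cG u))) \<noteq> 0"
      using card_color_class_pos[OF T(1), of cG] card_color_class_pos[OF tuple_update[OF T(1) kk(1)], of cG a]
      unfolding of_nat_eq_0_iff by linarith+
    ultimately have "real ?m / real (card (color_class k cG ?d)) = 1 / real (card (color_class k cG (cG u)))"
      unfolding frac_eq_eq[OF nz] by (simp only: mult_1 mult.commute)
    then show ?thesis unfolding sum using True by (simp add: color_weight_def)
  next
    case False
    have "cH (v(k := b)) \<noteq> ?d" for b
    proof
      assume "cH (v(k := b)) = ?d"
      then have "v(k := b) \<in> color_class k cH ?d" using T kk by (simp add: color_class_def)
      from copy[OF this] show False using False last(2) kk by (simp add: fun_upd_idem)
    qed
    then show ?thesis using False unfolding sum by (simp add: color_weight_def)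
  qed
qed

text \<open>Pairs adjacent in direction \<open>i\<close> between two classes are counted from either
  end, which balances the two degrees against the two class sizes.\<close>

lemma color_weight_nbrs:
  assumes T: "u \<in> tuples k" "v \<in> tuples k" and i: "i \<in> {1..k}"
  shows "(\<Sum>w\<in>nbrs G (u i). color_weight k cG cH (u(i := w)) v) =
      (\<Sum>w\<in>nbrs H (v i). color_weight k cG cH u (v(i := w)))"
proof -
  \<comment> \<open>Both classes lie in \<open>G\<close>, with \<open>v\<close> entering only
    through its colour, so the double count stays inside one graph.\<close>
  let ?A = "color_class k cG (cG u)" and ?B = "color_class k cG (cH v)"
  have lhs: "(\<Sum>w\<in>nbrs G (u i). color_weight k cG cH (u(i := w)) v) =
      real (card (tuple_nbrs G i u \<inter> ?B)) / real (card ?B)"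
  proof -
    have "(\<Sum>w\<in>nbrs G (u i). color_weight k cG cH (u(i := w)) v) =
        (\<Sum>w\<in>nbrs G (u i). if cG (u(i := w)) = cH v then 1 / real (card ?B) else 0)"
      by (intro sum.cong) (auto simp: color_weight_def)
    then show ?thesis
      unfolding tuple_nbrs_eq card_replacements_color_class[OF T(1) i]
      by (simp add: sum.If_cases Int_def)
  qed
  have rhs: "(\<Sum>w\<in>nbrs H (v i). color_weight k cG cH u (v(i := w))) =
      real (card (tuple_nbrs H i v \<inter> color_class k cH (cG u))) / real (card ?A)"
  proof -
    have "(\<Sum>w\<in>nbrs H (v i). color_weight k cG cH u (v(i := w))) =
        (\<Sum>w\<in>nbrs H (v i). if cH (v(i := w)) = cG u then 1 / real (card ?A) else 0)"
      by (intro sum.cong) (auto simp: color_weight_def)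
    then show ?thesis
      unfolding tuple_nbrs_eq card_replacements_color_class[OF T(2) i]
      by (simp add: sum.If_cases Int_def)
  qed
  have "card ?A * card (tuple_nbrs G i u \<inter> ?B) = (\<Sum>x\<in>?A. card (tuple_nbrs G i x \<inter> ?B))"
    using stable_pair.nbrs_card[OF self _ T(1) _ i] by (simp add: color_class_def)
  also have "\<dots> = (\<Sum>x\<in>?A. card {y \<in> ?B. y \<in> tuple_nbrs G i x})"
    by (simp add: Int_def conj_commute)
  also have "\<dots> = (\<Sum>y\<in>?B. card {x \<in> ?A. y \<in> tuple_nbrs G i x})"
    by (rule sum_multicount_gen) simp_all
  also have "\<dots> = (\<Sum>y\<in>?B. card (tuple_nbrs G i y \<inter> ?A))"
    unfolding tuple_nbrs_eq
    by (subst mem_replacements_commute[OF mem_nbrs_commute]) (simp add: Int_def conj_commute)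
  also have "\<dots> = card ?B * card (tuple_nbrs H i v \<inter> color_class k cH (cG u))"
    using nbrs_card[OF _ T(2) _ i] by (simp add: color_class_def)
  finally have "card ?A * card (tuple_nbrs G i u \<inter> ?B) =
      card ?B * card (tuple_nbrs H i v \<inter> color_class k cH (cG u))" .
  then have "real (card ?A) * real (card (tuple_nbrs G i u \<inter> ?B)) =
      real (card ?B) * real (card (tuple_nbrs H i v \<inter> color_class k cH (cG u)))"
    by (simp flip: of_nat_mult)
  moreover have nz: "real (card ?A) \<noteq> 0" "real (card ?B) \<noteq> 0"
    using card_color_class_pos[OF T(1), of cG] card_color_class_pos[OF T(2), of cH]
    unfolding class_card of_nat_eq_0_iff by linarith+
  ultimately show ?thesis
    unfolding lhs rhs frac_eq_eq[OF nz(2,1)] by (simp only: mult.commute)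
qed

end

section \<open>Realizing sets of pairs by tuples\<close>

definition diag_tuple :: "nat \<Rightarrow> 'n \<Rightarrow> nat \<Rightarrow> 'n" where
  "diag_tuple k a = (\<lambda>i\<in>{1..k}. a)"

lemma diag_tuple_mem [simp]: "diag_tuple k a \<in> tuples k"
  by (simp add: diag_tuple_def tuples_def)

lemma tuple_pairs_diag: "k \<ge> 1 \<Longrightarrow> tuple_pairs k (diag_tuple k a) (diag_tuple k b) = {(a, b)}"
  by (auto simp: tuple_pairs_def diag_tuple_def image_iff)

text \<open>Surplus indices repeat the first element. The extra index \<open>Suc m\<close> also does
  so, which later makes the last coordinate a copy of the first.\<close>

lemma ex_enumeration_with_repetition:
  assumes "finite S" "S \<noteq> {}" "card S \<le> m"
  obtains h :: "nat \<Rightarrow> 'a" where "h ` {1..m} = S" "h (Suc m) = h 1"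
proof -
  obtain e where e: "bij_betw e {1..card S} S"
    using ex_bij_betw_nat_finite_1[OF assms(1)] by blast
  define h where "h i = (if i \<le> card S then e i else e 1)" for i
  have S: "e i \<in> S" if "1 \<le> i" "i \<le> card S" for i
    using bij_betwE[OF e] that by simp
  have c: "1 \<le> card S" using assms by (simp add: Suc_le_eq card_gt_0_iff)
  have "h ` {1..m} = S"
  proof (intro equalityI subsetI)
    fix x assume "x \<in> h ` {1..m}"
    then obtain i where "i \<in> {1..m}" "x = h i" by blast
    then show "x \<in> S" using S c by (auto simp: h_def)
  next
    fix x assume "x \<in> S"
    then obtain i where "i \<in> {1..card S}" "x = e i"
      using bij_betw_imp_surj_on[OF e] by blast
    then show "x \<in> h ` {1..m}"
      using assms(3) by (intro image_eqI[where x = i]) (auto simp: h_def)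
  qed
  moreover have "h (Suc m) = h 1" using assms(3) c by (simp add: h_def)
  ultimately show ?thesis by (rule that)
qed

lemma ex_tuple_pairs:
  fixes S :: "('n::finite \<times> 'n) set"
  assumes "S \<noteq> {}" "card S \<le> k"
  obtains u v where "u \<in> tuples k" "v \<in> tuples k" "S = tuple_pairs k u v"
proof -
  obtain h where h: "h ` {1..k} = S"
    by (rule ex_enumeration_with_repetition[OF _ assms]) simp
  have "S = tuple_pairs k (\<lambda>i\<in>{1..k}. fst (h i)) (\<lambda>i\<in>{1..k}. snd (h i))"
    unfolding tuple_pairs_def h[symmetric] by (intro image_cong) auto
  then show ?thesis by (intro that) (auto simp: tuples_def)
qed

text \<open>Fewer than \<open>k\<close> pairs leave the last coordinate free.\<close>

lemma ex_tuple_pairs_free_last: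
  fixes I :: "('n::finite \<times> 'n) set"
  assumes "I \<noteq> {}" "card I \<le> k - 1"
  obtains u v where "u \<in> tuples k" "v \<in> tuples k" "u k = u 1" "v k = v 1" "k \<ge> 2"
    "I = tuple_pairs k u v" "\<And>a b. insert (a, b) I = tuple_pairs k (u(k := a)) (v(k := b))"
proof -
  obtain h where h: "h ` {1..k-1} = I" "h (Suc (k-1)) = h 1"
    by (rule ex_enumeration_with_repetition[OF _ assms]) simp
  have "card I \<noteq> 0" using assms(1) by simp
  then have k: "k \<ge> 2" using assms(2) by linarith
  then have kk: "k \<in> {1..k}" "1 \<in> {1..k}" "{1..k} - {k} = {1..k-1}" "Suc (k-1) = k" by auto
  let ?u = "\<lambda>i\<in>{1..k}. fst (h i)" and ?v = "\<lambda>i\<in>{1..k}. snd (h i)"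
  have T: "?u \<in> tuples k" "?v \<in> tuples k" by (auto simp: tuples_def)
  have last: "?u k = ?u 1" "?v k = ?v 1" using h(2) kk by simp_all
  have ins: "insert (a, b) I = tuple_pairs k (?u(k := a)) (?v(k := b))" for a b
  proof -
    have "(\<lambda>j. (?u j, (?v(k := b)) j)) ` ({1..k} - {k}) = h ` {1..k-1}"
      unfolding kk(3) using k by (intro image_cong) auto
    then show ?thesis
      unfolding tuple_pairs_update_left[OF kk(1)] h(1) by simp
  qed
  have "I = tuple_pairs k ?u ?v"
  proof -
    have "insert (h 1) I = I" using h(1) k by (force simp: insert_absorb)
    moreover have "insert (h 1) I = tuple_pairs k (?u(k := fst (h 1))) (?v(k := snd (h 1)))"
      using ins[of "fst (h 1)" "snd (h 1)"] by simp
    moreover have "?u(k := fst (h 1)) = ?u" "?v(k := snd (h 1)) = ?v"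
      using last kk by (auto simp: fun_upd_idem)
    ultimately show ?thesis by simp
  qed
  from that[OF T last k this ins] show ?thesis .
qed

context stable_pair
begin

text \<open>This is the row equation for \<open>I = {}\<close>. A class containing a constant tuple
  consists of constant tuples, so the nonzero summands correspond exactly to its members.\<close>

lemma color_weight_diag_row:
  "(\<Sum>b\<in>UNIV. color_weight k cG cH (diag_tuple k a) (diag_tuple k b)) = 1"
proof -
  let ?d = "cG (diag_tuple k a)"
  have kk: "1 \<in> {1..k}" using k_pos by simp
  have "bij_betw (diag_tuple k) {b. cH (diag_tuple k b) = ?d} (color_class k cH ?d)"
    unfolding bij_betw_def
  proof
    have "b = c" if "diag_tuple k b = diag_tuple k c" for b c :: 'n
      using fun_cong[OF that, of 1] kk by (simp add: diag_tuple_def)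
    then show "inj_on (diag_tuple k) {b. cH (diag_tuple k b) = ?d}" by (auto simp: inj_on_def)
    show "diag_tuple k ` {b. cH (diag_tuple k b) = ?d} = color_class k cH ?d"
    proof (intro equalityI subsetI)
      fix x assume x: "x \<in> color_class k cH ?d"
      then have xT: "x \<in> tuples k" and xc: "?d = cH x" by (auto simp: color_class_def)
      have "x = diag_tuple k (x 1)"
      proof (rule tuple_eqI[OF xT diag_tuple_mem])
        fix i assume i: "i \<in> {1..k}"
        show "x i = diag_tuple k (x 1) i"
          using coord_eq_iff[OF diag_tuple_mem xT xc i kk] i kk by (simp add: diag_tuple_def)
      qed
      then show "x \<in> diag_tuple k ` {b. cH (diag_tuple k b) = ?d}" using xc by auto
    qed (auto simp: color_class_def)
  qed
  then have c: "card {b. cH (diag_tuple k b) = ?d} = card (color_class k cG ?d)"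
    by (simp add: bij_betw_same_card class_card)
  have "(\<Sum>b\<in>UNIV. color_weight k cG cH (diag_tuple k a) (diag_tuple k b)) =
      (\<Sum>b\<in>UNIV. if cH (diag_tuple k b) = ?d then 1 / real (card (color_class k cG ?d)) else 0)"
    by (intro sum.cong) (auto simp: color_weight_def)
  also have "\<dots> = real (card {b. cH (diag_tuple k b) = ?d}) / real (card (color_class k cG ?d))"
    by (simp add: sum.If_cases)
  also have "\<dots> = 1"
    using card_color_class_pos[OF diag_tuple_mem, of k cG a] unfolding c by (metis divide_self_if less_irrefl of_nat_eq_0_iff)
  finally show ?thesis .
qed

lemma ex_relaxed_iso:
  "\<exists>Y. relaxed_iso k G H Y \<and>
    (\<forall>a b. Y {(a, b)} = color_weight k cG cH (diag_tuple k a) (diag_tuple k b))"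
proof -
  let ?W = "color_weight k cG cH"
  \<comment> \<open>Sets of more than \<open>k\<close> pairs come from no tuples and receive an
    arbitrary value, which \<open>relaxed_iso\<close> does not constrain.\<close>
  define Y where "Y S = (if S = {} then 1 else
    SOME r. \<exists>u\<in>tuples k. \<exists>v\<in>tuples k. S = tuple_pairs k u v \<and> r = ?W u v)" for S
  have Y: "Y (tuple_pairs k u v) = ?W u v" if "u \<in> tuples k" "v \<in> tuples k" for u v
  proof -
    have "tuple_pairs k u v \<noteq> {}" using k_pos by (simp add: tuple_pairs_def)
    moreover have "(SOME r. \<exists>u'\<in>tuples k. \<exists>v'\<in>tuples k. tuple_pairs k u v = tuple_pairs k u' v' \<and> r = ?W u' v')
        = ?W u v"
      proof (rule some_equality)
      show "r = ?W u v" if "\<exists>u'\<in>tuples k. \<exists>v'\<in>tuples k. tuple_pairs k u v = tuple_pairs k u' v' \<and> r = ?W u' v'" for r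
        using that color_weight_cong \<open>u \<in> tuples k\<close> \<open>v \<in> tuples k\<close> by metis
    qed (use that in blast)
    ultimately show ?thesis by (simp add: Y_def)
  qed
  have Ydiag: "Y {(a, b)} = ?W (diag_tuple k a) (diag_tuple k b)" for a b
    using Y[OF diag_tuple_mem diag_tuple_mem, of a b] by (simp only: tuple_pairs_diag[OF k_pos])
  have Y0: "Y {} = 1" by (simp add: Y_def)
  have kk: "k \<in> {1..k}" using k_pos by simp
  have nonneg: "0 \<le> Y S" if c: "card S \<le> k" for S
  proof (cases "S = {}")
    case False
    then obtain u v where "u \<in> tuples k" "v \<in> tuples k" "S = tuple_pairs k u v"
      using ex_tuple_pairs[OF False c] by metis
    then show ?thesis by (simp add: Y color_weight_def)
  qed (simp add: Y_def)
  have row: "(\<Sum>v\<in>UNIV. Y (insert (u, v) I)) = Y I" if c: "card I \<le> k - 1" for u I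
  proof (cases "I = {}")
    case True
    then show ?thesis using color_weight_diag_row by (simp add: Ydiag Y0)
  next
    case False
    obtain p q where p: "p \<in> tuples k" "q \<in> tuples k" "p k = p 1" "q k = q 1" "k \<ge> 2"
      and I: "I = tuple_pairs k p q" "\<And>a b. insert (a, b) I = tuple_pairs k (p(k := a)) (q(k := b))"
      using ex_tuple_pairs_free_last[OF False c] by metis
    show ?thesis
      using color_weight_row[OF p(5,1-4)] p(1,2) kk unfolding I(2) unfolding I(1) by (simp add: Y)
  qed
  have col: "(\<Sum>u\<in>UNIV. Y (insert (u, v) I)) = Y I" if c: "card I \<le> k - 1" for v I
  proof (cases "I = {}")
    case True
    then show ?thesis
      using stable_pair.color_weight_diag_row[OF swap] by (simp add: Ydiag Y0 color_weight_swap)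
  next
    case False
    obtain p q where p: "p \<in> tuples k" "q \<in> tuples k" "p k = p 1" "q k = q 1" "k \<ge> 2"
      and I: "I = tuple_pairs k p q" "\<And>a b. insert (a, b) I = tuple_pairs k (p(k := a)) (q(k := b))"
      using ex_tuple_pairs_free_last[OF False c] by metis
    show ?thesis
      using stable_pair.color_weight_row[OF swap p(5,2,1,4,3)] p(1,2) kk unfolding I(2) unfolding I(1)
      by (simp add: Y color_weight_swap)
  qed
  have nonempty: "(\<Sum>w\<in>nbrs G a. Y (insert (w, b) I)) = (\<Sum>w\<in>nbrs H b. Y (insert (a, w) I))"
    if I: "u \<in> tuples k" "v \<in> tuples k"
      "\<And>a b. insert (a, b) I = tuple_pairs k (u(k := a)) (v(k := b))" for a b u v I
    using color_weight_nbrs[of "u(k := a)" "v(k := b)" k] I(1,2) kk unfolding I(3) by (simp add: Y)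
  have nbrs: "(\<Sum>w\<in>nbrs G a. Y (insert (w, b) I)) = (\<Sum>w\<in>nbrs H b. Y (insert (a, w) I))"
    if c: "card I \<le> k - 1" for a b I
  proof -
    consider "I \<noteq> {}" | "I = {}" "k = 1" | "I = {}" "k \<ge> 2" using k_pos by linarith
    then show ?thesis
    proof cases
      case 1
      obtain p q where "p \<in> tuples k" "q \<in> tuples k"
        "\<And>c d. insert (c, d) I = tuple_pairs k (p(k := c)) (q(k := d))"
        using ex_tuple_pairs_free_last[OF 1 c] by metis
      then show ?thesis by (rule nonempty)
    next
      \<comment> \<open>For \<open>k = 1\<close> updating the only coordinate leaves no other pair,
        so the tuple equation already has \<open>I = {}\<close>.\<close>
      case 2
      then show ?thesis
        by (intro nonempty[of "diag_tuple k a" "diag_tuple k b"]) (auto simp: tuple_pairs_def)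
    next
      \<comment> \<open>An auxiliary pair \<open>(a, x)\<close> is introduced by summing over row
        \<open>a\<close>; the equation for \<open>I = {(a, x)}\<close> applies, and \<open>x\<close>
        is summed out again.\<close>
      case 3
      have "Y {(w, b)} = (\<Sum>x\<in>UNIV. Y {(w, b), (a, x)})" for w
        using row[of "{(w, b)}" a] 3 by (simp add: insert_commute)
      then have "(\<Sum>w\<in>nbrs G a. Y {(w, b)}) = (\<Sum>w\<in>nbrs G a. \<Sum>x\<in>UNIV. Y {(w, b), (a, x)})"
        by (simp only:)
      also have "\<dots> = (\<Sum>x\<in>UNIV. \<Sum>w\<in>nbrs G a. Y {(w, b), (a, x)})"
        by (rule sum.swap)
      also have "\<dots> = (\<Sum>x\<in>UNIV. \<Sum>w\<in>nbrs H b. Y {(a, w), (a, x)})"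
      proof (rule sum.cong[OF refl])
        fix x :: 'n
        have ax: "{(a, x)} \<noteq> {}" "card {(a, x)} \<le> k - 1" using 3 by simp_all
        obtain p q where "p \<in> tuples k" "q \<in> tuples k"
          "\<And>c d. insert (c, d) {(a, x)} = tuple_pairs k (p(k := c)) (q(k := d))"
          using ex_tuple_pairs_free_last[OF ax] by metis
        then show "(\<Sum>w\<in>nbrs G a. Y {(w, b), (a, x)}) = (\<Sum>w\<in>nbrs H b. Y {(a, w), (a, x)})"
          by (rule nonempty)
      qed
      also have "\<dots> = (\<Sum>w\<in>nbrs H b. \<Sum>x\<in>UNIV. Y {(a, x), (a, w)})"
        by (subst sum.swap) (simp only: insert_commute)
      also have "\<dots> = (\<Sum>w\<in>nbrs H b. Y {(a, w)})"
        by (intro sum.cong refl row) (use 3 in simp)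
      finally show ?thesis using 3 by simp
    qed
  qed
  have "relaxed_iso k G H Y"
    unfolding relaxed_iso_def using nonneg row col nbrs Y0 by blast
  with Ydiag show ?thesis by blast
qed

end

section \<open>Iteration to stability\<close>

lemma nat_decreasing_stationary:
  fixes m :: "nat \<Rightarrow> nat"
  assumes "\<And>t. m (Suc t) \<le> m t"
  shows "\<exists>t. m (Suc t) = m t"
proof (rule ccontr)
  assume "\<nexists>t. m (Suc t) = m t"
  then have less: "m (Suc t) < m t" for t using assms le_neq_implies_less by blast
  have "m t + t \<le> m 0" for t
  proof (induction t)
    case (Suc t)
    then show ?case using less[of t] by linarith
  qed simp
  from this[of "Suc (m 0)"] show False by simp
qed

text \<open>The last conclusion allows two sequences that stabilize at different times to be
  compared at a common later time.\<close>

lemma iterate_until_stable: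
  assumes "(f ^^ Suc t) x = (f ^^ t) x"
  obtains s where "iterate_until_stable f x = (f ^^ s) x"
    "f (iterate_until_stable f x) = iterate_until_stable f x"
    "\<And>n. s \<le> n \<Longrightarrow> (f ^^ n) x = iterate_until_stable f x"
proof -
  define s where "s = (LEAST t. (f ^^ Suc t) x = (f ^^ t) x)"
  have stable: "iterate_until_stable f x = (f ^^ s) x"
    by (simp only: s_def iterate_until_stable_def)
  have s: "f ((f ^^ s) x) = (f ^^ s) x"
    using LeastI[of "\<lambda>t. (f ^^ Suc t) x = (f ^^ t) x", OF assms] by (simp only: s_def funpow.simps comp_apply)
  have "(f ^^ (j + s)) x = (f ^^ s) x" for j
    by (induction j) (simp_all add: s)
  then have "(f ^^ n) x = (f ^^ s) x" if "s \<le> n" for n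
    using that by (metis le_add_diff_inverse2)
  then show ?thesis using s unfolding stable[symmetric] by (intro that[OF stable])
qed

lemma comb_matrix_eq_iff:
  "comb_matrix k G u = comb_matrix k H v \<longleftrightarrow>
    (\<forall>i\<in>{1..k}. \<forall>j\<in>{1..k}. comb_entry G u i j = comb_entry H v i j)"
proof -
  have "set [1..<k + 1] = {1..k}" by auto
  then show ?thesis unfolding comb_matrix_def map_eq_conv by (simp only:)
qed

text \<open>Hence the entry of \<open>Y\<close> at two tuples is unchanged when both are permuted
  alike, which handles the permutation components of each round.\<close>

lemma tuple_pairs_permute:
  assumes "\<sigma> permutes {1..k}"
  shows "tuple_pairs k (u \<circ> \<sigma>) (v \<circ> \<sigma>) = tuple_pairs k u v"
proof -
  have "tuple_pairs k (u \<circ> \<sigma>) (v \<circ> \<sigma>) = (\<lambda>i. (u i, v i)) ` (\<sigma> ` {1..k})"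
    by (simp add: tuple_pairs_def image_image)
  then show ?thesis unfolding permutes_image[OF assms] tuple_pairs_def .
qed

section \<open>Automorphism version\<close>

lemma same_cell_quotient:
  assumes "equiv A r"
  shows "same_cell (A // r) u v \<longleftrightarrow> (u, v) \<in> r"
proof
  assume "same_cell (A // r) u v"
  then show "(u, v) \<in> r"
    using quotient_eq_iff[OF assms] unfolding same_cell_def by blast
next
  assume uv: "(u, v) \<in> r"
  then have "u \<in> A" using assms equiv_class_eq_iff by metis
  then have "r `` {u} \<in> A // r" "u \<in> r `` {u}" "v \<in> r `` {u}"
    using uv equiv_class_self[OF assms] by (auto intro: quotientI)
  then show "same_cell (A // r) u v" by (auto simp: same_cell_def)
qed

text \<open>With the equivalence class itself as colour, cells and colour classes coincide.\<close>

lemma color_class_equiv: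
  assumes "equiv (tuples k) r" "x \<in> tuples k"
  shows "color_class k (\<lambda>u. r `` {u}) (r `` {x}) = r `` {x}"
proof -
  have "u \<in> tuples k \<and> r `` {u} = r `` {x} \<longleftrightarrow> (x, u) \<in> r" for u
    using eq_equiv_class_iff[OF assms(1)] assms equiv_class_eq_iff[OF assms(1)] by blast
  then show ?thesis by (auto simp: color_class_def)
qed

context
  fixes k :: nat and \<sigma>1 \<sigma>2 :: "nat \<Rightarrow> nat" and G :: "'n::finite set set"
  assumes k: "k \<ge> 1" and gen: "generates_sym k \<sigma>1 \<sigma>2"
begin

text \<open>One round expressed on relations, where refinement is plain inclusion.\<close>

definition refine_equiv ::
    "((nat \<Rightarrow> 'n) \<times> (nat \<Rightarrow> 'n)) set \<Rightarrow> ((nat \<Rightarrow> 'n) \<times> (nat \<Rightarrow> 'n)) set" where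
  "refine_equiv r = cvc_equiv k \<sigma>1 \<sigma>2 G (tuples k // r)"

lemma generators_permute: "\<sigma>1 permutes {1..k}" "\<sigma>2 permutes {1..k}"
  using gen by (auto simp: generates_sym_def)

lemma mem_refine_equiv:
  assumes "equiv (tuples k) r"
  shows "(u, v) \<in> refine_equiv r \<longleftrightarrow> u \<in> tuples k \<and> v \<in> tuples k \<and> (u, v) \<in> r \<and>
    (u \<circ> \<sigma>1, v \<circ> \<sigma>1) \<in> r \<and> (u \<circ> \<sigma>2, v \<circ> \<sigma>2) \<in> r \<and> comb_matrix k G u = comb_matrix k G v \<and>
    (\<forall>C\<in>tuples k // r. \<forall>i\<in>{1..k}.
      card (tuple_nbrs G i u \<inter> C) = card (tuple_nbrs G i v \<inter> C) \<and>
      card (tuple_nonnbrs G i u \<inter> C) = card (tuple_nonnbrs G i v \<inter> C))"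
  unfolding refine_equiv_def cvc_equiv_def by (simp add: same_cell_quotient[OF assms])

lemma equiv_refine_equiv:
  assumes r: "equiv (tuples k) r"
  shows "equiv (tuples k) (refine_equiv r)"
proof (rule equivI)
  have T: "u \<circ> \<sigma>1 \<in> tuples k" "u \<circ> \<sigma>2 \<in> tuples k" if "u \<in> tuples k" for u :: "nat \<Rightarrow> 'n"
    using that generators_permute tuple_permute by blast+
  have rr: "\<And>u. u \<in> tuples k \<Longrightarrow> (u, u) \<in> r" "\<And>u v. (u, v) \<in> r \<Longrightarrow> (v, u) \<in> r"
    "\<And>u v w. (u, v) \<in> r \<Longrightarrow> (v, w) \<in> r \<Longrightarrow> (u, w) \<in> r"
    using r by (auto simp: equiv_def refl_on_def dest: symD transD)
  show "refine_equiv r \<subseteq> tuples k \<times> tuples k"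
    using mem_refine_equiv[OF r] by auto
  show "refl_on (tuples k) (refine_equiv r)"
    using T rr(1) by (intro refl_onI) (auto simp: mem_refine_equiv[OF r])
  show "sym (refine_equiv r)"
    using rr(2) by (intro symI) (simp add: mem_refine_equiv[OF r])
  show "trans (refine_equiv r)"
    unfolding trans_def mem_refine_equiv[OF r] using rr(3) by metis
qed

lemma refine_equiv_subset: "equiv (tuples k) r \<Longrightarrow> refine_equiv r \<subseteq> r"
  using mem_refine_equiv by auto

definition equiv_seq :: "nat \<Rightarrow> ((nat \<Rightarrow> 'n) \<times> (nat \<Rightarrow> 'n)) set" where
  "equiv_seq t = (refine_equiv ^^ t) (tuples k \<times> tuples k)"

lemma equiv_seq_simps:
  "equiv_seq 0 = tuples k \<times> tuples k" "equiv_seq (Suc t) = refine_equiv (equiv_seq t)"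
  by (simp_all add: equiv_seq_def)

lemma equiv_equiv_seq: "equiv (tuples k) (equiv_seq t)"
proof (induction t)
  case 0
  show ?case unfolding equiv_seq_simps by (auto simp: equiv_def refl_on_def sym_def trans_def)
qed (simp add: equiv_seq_simps equiv_refine_equiv)

lemma equiv_seq_mem: "(u, v) \<in> equiv_seq t \<Longrightarrow> u \<in> tuples k \<and> v \<in> tuples k"
  using equiv_class_eq_iff[OF equiv_equiv_seq] by metis

lemma cvc_refine_iterate:
  "(cvc_refine k \<sigma>1 \<sigma>2 G ^^ t) {tuples k} = tuples k // equiv_seq t"
proof (induction t)
  case 0
  have "diag_tuple k undefined \<in> (tuples k :: (nat \<Rightarrow> 'n) set)" by simp
  then have "tuples k // (tuples k \<times> tuples k) = {tuples k :: (nat \<Rightarrow> 'n) set}"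
    unfolding quotient_def Image_def by blast
  then show ?case by (simp only: equiv_seq_simps funpow.simps id_apply)
qed (simp add: equiv_seq_simps refine_equiv_def cvc_refine_def)

text \<open>The relations shrink inside a finite set, so their cardinalities become stationary; a
  partition determines its relation, so stability transfers back.\<close>

lemma cvc_stable_quotient:
  obtains t where "cvc_stable k \<sigma>1 \<sigma>2 G = tuples k // equiv_seq t"
    "refine_equiv (equiv_seq t) = equiv_seq t"
proof -
  have fin: "finite (equiv_seq t)" for t
    by (rule finite_subset[of _ "tuples k \<times> tuples k"]) (auto dest: equiv_seq_mem)
  have sub: "equiv_seq (Suc t) \<subseteq> equiv_seq t" for t
    using refine_equiv_subset[OF equiv_equiv_seq] by (simp add: equiv_seq_simps)
  have "card (equiv_seq (Suc t)) \<le> card (equiv_seq t)" for t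
    by (rule card_mono[OF fin sub])
  then obtain t where "card (equiv_seq (Suc t)) = card (equiv_seq t)"
    using nat_decreasing_stationary[of "\<lambda>t. card (equiv_seq t)"] by blast
  then have "equiv_seq (Suc t) = equiv_seq t" by (rule card_subset_eq[OF fin sub])
  then have "(cvc_refine k \<sigma>1 \<sigma>2 G ^^ Suc t) {tuples k} = (cvc_refine k \<sigma>1 \<sigma>2 G ^^ t) {tuples k}"
    by (simp only: cvc_refine_iterate)
  then obtain s where s: "cvc_stable k \<sigma>1 \<sigma>2 G = (cvc_refine k \<sigma>1 \<sigma>2 G ^^ s) {tuples k}"
    and "cvc_refine k \<sigma>1 \<sigma>2 G (cvc_stable k \<sigma>1 \<sigma>2 G) = cvc_stable k \<sigma>1 \<sigma>2 G"
    unfolding cvc_stable_def by (rule iterate_until_stable)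
  then have "tuples k // refine_equiv (equiv_seq s) = tuples k // equiv_seq s"
    by (simp add: cvc_refine_iterate cvc_refine_def refine_equiv_def)
  then have "(u, v) \<in> refine_equiv (equiv_seq s) \<longleftrightarrow> (u, v) \<in> equiv_seq s" for u v
    using same_cell_quotient[OF equiv_equiv_seq, of s u v]
      same_cell_quotient[OF equiv_refine_equiv[OF equiv_equiv_seq], of s u v]
    by (simp only:)
  then have "refine_equiv (equiv_seq s) = equiv_seq s" by auto
  then show ?thesis using s unfolding cvc_refine_iterate by (intro that)
qed

text \<open>If the support of \<open>Y\<close> respects the cells of one round, all data compared in
  the next round agree along it.\<close>

lemma relaxed_iso_equiv_seq:
  assumes Y: "relaxed_iso k G G Y" and uv: "u \<in> tuples k" "v \<in> tuples k" "0 < Y (tuple_pairs k u v)"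
  shows "(u, v) \<in> equiv_seq t"
  using uv
proof (induction t arbitrary: u v)
  case 0
  then show ?case by (simp add: equiv_seq_simps)
next
  case (Suc t)
  let ?r = "equiv_seq t"
  have supp: "?r `` {u} = ?r `` {v}" if "u \<in> tuples k" "v \<in> tuples k" "0 < Y (tuple_pairs k u v)" for u v
    using Suc.IH[OF that] by (rule equiv_class_eq[OF equiv_equiv_seq])
  have deg: "card (tuple_nbrs G i u \<inter> C) = card (tuple_nbrs G i v \<inter> C) \<and>
      card (tuple_nonnbrs G i u \<inter> C) = card (tuple_nonnbrs G i v \<inter> C)"
    if C: "C \<in> tuples k // ?r" and i: "i \<in> {1..k}" for C i
  proof -
    obtain x where x: "x \<in> tuples k" "C = ?r `` {x}" using C by (rule quotientE)
    have cc: "color_class k (\<lambda>u. ?r `` {u}) C = C"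
      using color_class_equiv[OF equiv_equiv_seq x(1)] x(2) by simp
    show ?thesis
      using relaxed_iso_degree[OF Y, where cG = "\<lambda>u. ?r `` {u}" and cH = "\<lambda>u. ?r `` {u}" and d = C,
          OF supp i Suc.prems] unfolding cc by (rule conjI)
  qed
  have perm: "(u \<circ> \<sigma>, v \<circ> \<sigma>) \<in> ?r" if "\<sigma> permutes {1..k}" for \<sigma>
  proof (rule Suc.IH)
    show "0 < Y (tuple_pairs k (u \<circ> \<sigma>) (v \<circ> \<sigma>))"
      unfolding tuple_pairs_permute[OF that] by (rule Suc.prems(3))
  qed (rule tuple_permute[OF _ that], rule Suc.prems)+
  show ?case
    unfolding equiv_seq_simps mem_refine_equiv[OF equiv_equiv_seq]
    using deg
    by (intro conjI ballI Suc.prems(1,2) Suc.IH[OF Suc.prems] perm generators_permute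
        relaxed_iso_comb_matrix[OF Y Suc.prems(3)]) blast+
qed

lemma stable_pair_equiv_seq:
  assumes stable: "refine_equiv (equiv_seq t) = equiv_seq t"
  shows "stable_pair k G G (\<lambda>u. equiv_seq t `` {u}) (\<lambda>u. equiv_seq t `` {u})"
proof -
  let ?r = "equiv_seq t" and ?c = "\<lambda>u. equiv_seq t `` {u}"
  have iff: "?c u = ?c v \<longleftrightarrow> (u, v) \<in> ?r" if "u \<in> tuples k" "v \<in> tuples k" for u v
    using eq_equiv_class_iff[OF equiv_equiv_seq] that by blast
  have mem: "(u, v) \<in> refine_equiv ?r" if "u \<in> tuples k" "v \<in> tuples k" "?c u = ?c v" for u v
    using iff[OF that(1,2)] that(3) stable by simp
  note mem = mem[unfolded mem_refine_equiv[OF equiv_equiv_seq]]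
  show ?thesis
  proof
    fix u v :: "nat \<Rightarrow> 'n" assume uv: "u \<in> tuples k" "v \<in> tuples k" "?c u = ?c v"
    show "?c (u \<circ> \<tau>) = ?c (v \<circ> \<tau>)" if \<tau>: "\<tau> permutes {1..k}" for \<tau>
    proof (rule generates_sym_closed[where R = "\<lambda>u v. ?c u = ?c v", OF gen _ _ \<tau> uv])
      show "?c (u \<circ> \<sigma>1) = ?c (v \<circ> \<sigma>1)" if "u \<in> tuples k" "v \<in> tuples k" "?c u = ?c v" for u v
        using mem[OF that] equiv_class_eq[OF equiv_equiv_seq] by blast
      show "?c (u \<circ> \<sigma>2) = ?c (v \<circ> \<sigma>2)" if "u \<in> tuples k" "v \<in> tuples k" "?c u = ?c v" for u v
        using mem[OF that] equiv_class_eq[OF equiv_equiv_seq] by blast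
    qed
    show "comb_entry G u i j = comb_entry G v i j" if "i \<in> {1..k}" "j \<in> {1..k}" for i j
      using mem[OF uv] that unfolding comb_matrix_eq_iff by blast
    have "card (tuple_nbrs G i u \<inter> color_class k ?c d) = card (tuple_nbrs G i v \<inter> color_class k ?c d) \<and>
        card (tuple_nonnbrs G i u \<inter> color_class k ?c d) = card (tuple_nonnbrs G i v \<inter> color_class k ?c d)"
      if i: "i \<in> {1..k}" for i d
    proof (cases "\<exists>x\<in>tuples k. d = ?c x")
      case True
      then obtain x where x: "x \<in> tuples k" "d = ?c x" by blast
      then have "color_class k ?c d = d" "d \<in> tuples k // ?r"
        using color_class_equiv[OF equiv_equiv_seq x(1)] by (auto intro: quotientI)
      then show ?thesis using mem[OF uv] i by simp
    next
      case False
      then have "color_class k ?c d = {}" by (auto simp: color_class_def)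
      then show ?thesis by simp
    qed
    then show "card (tuple_nbrs G i u \<inter> color_class k ?c d) = card (tuple_nbrs G i v \<inter> color_class k ?c d)"
      "card (tuple_nonnbrs G i u \<inter> color_class k ?c d) = card (tuple_nonnbrs G i v \<inter> color_class k ?c d)"
      if "i \<in> {1..k}" for i d
      using that by blast+
  qed (simp_all only: k)
qed

text \<open>If only the identity is feasible, the weights vanish off the diagonal, so distinct
  constant tuples have distinct colours. Conversely, a discrete stable partition leaves no
  off-diagonal support. The point built from the stable colouring shows that the relaxation is
  nonempty.\<close>

lemma relaxation_identity_iff:
  "iso_relaxation k G G = {mat 1} \<longleftrightarrow> cvc_determines_asymmetric k \<sigma>1 \<sigma>2 G"
proof -
  obtain t where stable: "cvc_stable k \<sigma>1 \<sigma>2 G = tuples k // equiv_seq t"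
    "refine_equiv (equiv_seq t) = equiv_seq t"
    by (rule cvc_stable_quotient)
  let ?r = "equiv_seq t" and ?c = "\<lambda>u. equiv_seq t `` {u}"
  interpret stable_pair k G G ?c ?c
    by (rule stable_pair_equiv_seq[OF stable(2)])
  obtain Y where Y: "relaxed_iso k G G Y"
    and Y_diag: "\<And>a b. Y {(a, b)} = color_weight k ?c ?c (diag_tuple k a) (diag_tuple k b)"
    using ex_relaxed_iso by blast
  have member: "(\<chi> a b. Y {(a, b)}) \<in> iso_relaxation k G G"
    unfolding iso_relaxation_iff using Y by auto
  have asym: "cvc_determines_asymmetric k \<sigma>1 \<sigma>2 G \<longleftrightarrow> (\<forall>u v. (u, v) \<in> ?r \<longrightarrow> u = v)"
  proof -
    have "cvc_determines_asymmetric k \<sigma>1 \<sigma>2 G \<longleftrightarrow> (\<forall>u\<in>tuples k. is_singleton (?r `` {u}))"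
      unfolding cvc_determines_asymmetric_def stable(1) quotient_def by blast
    also have "\<dots> \<longleftrightarrow> (\<forall>u v. (u, v) \<in> ?r \<longrightarrow> u = v)"
    proof -
      have "is_singleton (?r `` {u}) \<longleftrightarrow> (\<forall>v. (u, v) \<in> ?r \<longrightarrow> u = v)" if "u \<in> tuples k" for u
      proof -
        have "(u, u) \<in> ?r" using equiv_class_self[OF equiv_equiv_seq that] by blast
        then have "is_singleton (?r `` {u}) \<longleftrightarrow> ?r `` {u} = {u}"
          unfolding is_singleton_def by (metis Image_singleton_iff singletonD)
        then show ?thesis using \<open>(u, u) \<in> ?r\<close> by auto
      qed
      moreover have "u \<in> tuples k" if "(u, v) \<in> ?r" for u v
        using equiv_seq_mem[OF that] by blast
      ultimately show ?thesis by blast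
    qed
    finally show ?thesis .
  qed
  show ?thesis
  proof
    assume "iso_relaxation k G G = {mat 1}"
    then have id: "(\<chi> a b. Y {(a, b)}) = (mat 1 :: real^'n^'n)" using member by simp
    have Y_zero: "Y {(a, b)} = 0" if "a \<noteq> b" for a b
      using arg_cong[OF id, of "\<lambda>M. M $ a $ b"] that by (simp add: mat_def)
    have diag: "a = b" if "?c (diag_tuple k a) = ?c (diag_tuple k b)" for a b
    proof (rule ccontr)
      assume "a \<noteq> b"
      then have "color_weight k ?c ?c (diag_tuple k a) (diag_tuple k b) = 0"
        using Y_zero Y_diag by simp
      then show False
        using that card_color_class_pos[OF diag_tuple_mem, of k ?c a] unfolding color_weight_def
        by (metis divide_eq_0_iff less_irrefl of_nat_eq_0_iff zero_neq_one)
    qed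
    show "cvc_determines_asymmetric k \<sigma>1 \<sigma>2 G"
      unfolding asym
    proof (intro allI impI)
      fix u v assume uv: "(u, v) \<in> ?r"
      then have T: "u \<in> tuples k" "v \<in> tuples k"
        using equiv_seq_mem[OF uv] by blast+
      have c: "?c u = ?c v" using uv by (rule equiv_class_eq[OF equiv_equiv_seq])
      show "u = v"
      proof (rule tuple_eqI[OF T])
        fix i assume i: "i \<in> {1..k}"
        \<comment> \<open>Collapsing all coordinates to \<open>i\<close> reduces equality at
          coordinate \<open>i\<close> to the case of constant tuples.\<close>
        let ?f = "\<lambda>j. if j \<in> {1..k} then i else j"
        have f: "\<And>j. j \<in> {1..k} \<Longrightarrow> ?f j \<in> {1..k}" "\<And>j. j \<notin> {1..k} \<Longrightarrow> ?f j = j"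
          using i by auto
        have d: "x \<circ> ?f = diag_tuple k (x i)" if "x \<in> tuples k" for x :: "nat \<Rightarrow> 'n"
          by (rule tuple_eqI[OF tuple_compose[OF that f] diag_tuple_mem]) (simp_all add: diag_tuple_def)
        have "?c (u \<circ> ?f) = ?c (v \<circ> ?f)" by (rule compose[OF T c f])
        then show "u i = v i" unfolding d[OF T(1)] d[OF T(2)] by (rule diag)
      qed
    qed
  next
    assume "cvc_determines_asymmetric k \<sigma>1 \<sigma>2 G"
    then have discrete: "\<And>u v. (u, v) \<in> ?r \<Longrightarrow> u = v" unfolding asym by blast
    have "X = mat 1" if "X \<in> iso_relaxation k G G" for X
    proof -
      obtain Z where Z: "relaxed_iso k G G Z" "\<And>a b. X $ a $ b = Z {(a, b)}"
        using \<open>X \<in> _\<close> unfolding iso_relaxation_iff by blast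
      have zero: "Z {(a, b)} = 0" if "a \<noteq> b" for a b
      proof (rule ccontr)
        assume "Z {(a, b)} \<noteq> 0"
        moreover have "0 \<le> Z {(a, b)}" using Z(1) k by (simp add: relaxed_iso_def)
        ultimately have "0 < Z (tuple_pairs k (diag_tuple k a) (diag_tuple k b))"
          by (simp add: tuple_pairs_diag[OF k])
        then have eq: "diag_tuple k a = diag_tuple k b"
          by (intro discrete relaxed_iso_equiv_seq[OF Z(1)]) simp_all
        have "a = b" using fun_cong[OF eq, of 1] k by (simp add: diag_tuple_def)
        then show False using that by blast
      qed
      have "Z {(a, a)} = 1" for a
      proof -
        have "(\<Sum>b\<in>UNIV. Z {(a, b)}) = 1" using Z(1) by (simp add: relaxed_iso_def)
        moreover have "(\<Sum>b\<in>UNIV. Z {(a, b)}) = (\<Sum>b\<in>UNIV. if b = a then Z {(a, a)} else 0)"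
          using zero by (intro sum.cong) auto
        ultimately show ?thesis by simp
      qed
      then show ?thesis using zero Z(2) by (simp add: vec_eq_iff mat_def)
    qed
    then have "iso_relaxation k G G \<subseteq> {mat 1}" by blast
    then show "iso_relaxation k G G = {mat 1}" using member subset_singletonD by fastforce
  qed
qed

end

section \<open>Isomorphism version\<close>

text \<open>Nonempty cells ensure that every index up to the length is attained, so lengths can be
  compared by counting indices.\<close>

definition ordered_partition :: "nat \<Rightarrow> (nat \<Rightarrow> 'n::finite) set list \<Rightarrow> bool" where
  "ordered_partition k \<pi> \<longleftrightarrow>
     (\<forall>i<length \<pi>. \<pi> ! i \<subseteq> tuples k \<and> \<pi> ! i \<noteq> {}) \<and>
     (\<forall>u\<in>tuples k. \<exists>!i. i < length \<pi> \<and> u \<in> \<pi> ! i)"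

lemma cell_index_unique:
  assumes "ordered_partition k \<pi>" "i < length \<pi>" "u \<in> \<pi> ! i"
  shows "cell_index \<pi> u = Suc i"
proof -
  have u: "u \<in> tuples k" using assms by (auto simp: ordered_partition_def)
  have unique: "j = i" if "j < length \<pi>" "u \<in> \<pi> ! j" for j
    using assms that u unfolding ordered_partition_def by blast
  show ?thesis
    unfolding cell_index_def
  proof (rule the_equality)
    show "Suc i \<in> {1..length \<pi>} \<and> u \<in> \<pi> ! (Suc i - 1)" using assms by simp
    fix j assume j: "j \<in> {1..length \<pi>} \<and> u \<in> \<pi> ! (j - 1)"
    then have "j - 1 = i" by (intro unique) auto
    then show "j = Suc i" using j by auto
  qed
qed

lemma cell_index_cell:
  assumes "ordered_partition k \<pi>" "u \<in> tuples k"
  obtains i where "i < length \<pi>" "u \<in> \<pi> ! i" "cell_index \<pi> u = Suc i"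
proof -
  obtain i where i: "i < length \<pi>" "u \<in> \<pi> ! i"
    using assms unfolding ordered_partition_def by blast
  then show ?thesis using cell_index_unique[OF assms(1) i] by (rule that)
qed

lemma color_class_cell_index:
  assumes \<pi>: "ordered_partition k \<pi>" and i: "i < length \<pi>"
  shows "color_class k (cell_index \<pi>) (Suc i) = \<pi> ! i"
proof (intro equalityI subsetI)
  fix u assume "u \<in> color_class k (cell_index \<pi>) (Suc i)"
  then show "u \<in> \<pi> ! i"
    by (auto simp: color_class_def elim: cell_index_cell[OF \<pi>])
next
  fix u assume "u \<in> \<pi> ! i"
  moreover have "u \<in> tuples k" using \<pi> i calculation by (auto simp: ordered_partition_def)
  ultimately show "u \<in> color_class k (cell_index \<pi>) (Suc i)"
    using cell_index_unique[OF \<pi> i] by (simp add: color_class_def)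
qed

lemma cell_index_image:
  assumes \<pi>: "ordered_partition k \<pi>"
  shows "cell_index \<pi> ` tuples k = {1..length \<pi>}"
proof (intro equalityI subsetI)
  fix x assume "x \<in> cell_index \<pi> ` tuples k"
  then show "x \<in> {1..length \<pi>}" by (auto elim: cell_index_cell[OF \<pi>])
next
  fix x assume x: "x \<in> {1..length \<pi>}"
  then have i: "x - 1 < length \<pi>" by auto
  then obtain u where u: "u \<in> \<pi> ! (x - 1)" "u \<in> tuples k"
    using \<pi> unfolding ordered_partition_def by blast
  have "cell_index \<pi> u = x" using cell_index_unique[OF \<pi> i u(1)] x by simp
  then show "x \<in> cell_index \<pi> ` tuples k" using u(2) by blast
qed

text \<open>The list of values is separate from the function, so that two graphs can be indexed by
  the same list.\<close>

definition level_sets :: "nat \<Rightarrow> ((nat \<Rightarrow> 'n::finite) \<Rightarrow> 'd) \<Rightarrow> 'd list \<Rightarrow> (nat \<Rightarrow> 'n) set list" where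
  "level_sets k D ds = map (\<lambda>d. {u \<in> tuples k. D u = d}) ds"

lemma ordered_partition_level_sets:
  assumes "distinct ds" "set ds = D ` tuples k"
  shows "ordered_partition k (level_sets k D ds)"
proof -
  have "\<exists>!i. i < length ds \<and> D u = ds ! i" if u: "u \<in> tuples k" for u
  proof -
    have "D u \<in> set ds" using assms(2) u by blast
    then obtain i where "i < length ds" "D u = ds ! i" by (metis in_set_conv_nth)
    then show ?thesis using assms(1) by (auto simp: nth_eq_iff_index_eq)
  qed
  moreover have "\<exists>u\<in>tuples k. D u = ds ! i" if "i < length ds" for i
    using nth_mem[OF that] assms(2) by (metis imageE)
  moreover have "i < length ds \<and> u \<in> map (\<lambda>d. {u \<in> tuples k. D u = d}) ds ! i \<longleftrightarrow>
      i < length ds \<and> D u = ds ! i" if "u \<in> tuples k" for u i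
    using that by auto
  moreover have "map (\<lambda>d. {u \<in> tuples k. D u = d}) ds ! i = {u \<in> tuples k. D u = ds ! i}"
    if "i < length ds" for i
    using that by simp
  ultimately show ?thesis
    unfolding ordered_partition_def level_sets_def length_map by (intro conjI allI impI ballI) (simp_all, blast+)
qed

lemma cell_index_level_sets:
  assumes "distinct ds" "set ds = D ` tuples k" "u \<in> tuples k" "i < length ds" "ds ! i = D u"
  shows "cell_index (level_sets k D ds) u = Suc i"
  by (rule cell_index_unique[OF ordered_partition_level_sets[OF assms(1,2)]])
    (use assms(3-5) in \<open>simp_all add: level_sets_def\<close>)

lemma cell_index_level_sets_eq_iff:
  assumes ds: "distinct ds" "set ds = D ` tuples k" "set ds = D' ` tuples k"
    and uv: "u \<in> tuples k" "v \<in> tuples k"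
  shows "cell_index (level_sets k D ds) u = cell_index (level_sets k D' ds) v \<longleftrightarrow> D u = D' v"
proof -
  obtain i where i: "i < length ds" "ds ! i = D u" using ds(2) uv(1) by (metis imageI in_set_conv_nth)
  obtain j where j: "j < length ds" "ds ! j = D' v" using ds(3) uv(2) by (metis imageI in_set_conv_nth)
  have "cell_index (level_sets k D ds) u = Suc i" by (rule cell_index_level_sets[OF ds(1,2) uv(1) i])
  moreover have "cell_index (level_sets k D' ds) v = Suc j" by (rule cell_index_level_sets[OF ds(1,3) uv(2) j])
  ultimately show ?thesis using i j ds(1) by (metis nat.inject nth_eq_iff_index_eq)
qed

section \<open>Decoding the flattened values\<close>

lemma concat_map_eq_iff:
  assumes "\<And>x. x \<in> set xs \<Longrightarrow> length (f x) = length (g x)"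
  shows "concat (map f xs) = concat (map g xs) \<longleftrightarrow> (\<forall>x\<in>set xs. f x = g x)"
  using assms by (induction xs) auto

lemma length_concat_comb_matrix: "length (concat (comb_matrix k G u)) = k * k"
  by (simp add: comb_matrix_def length_concat comp_def sum_list_triv)

lemma concat_comb_matrix_eq_iff:
  "concat (comb_matrix k G u) = concat (comb_matrix k H v) \<longleftrightarrow> comb_matrix k G u = comb_matrix k H v"
  unfolding comb_matrix_def by (subst concat_map_eq_iff) simp_all

text \<open>The length is \<open>3 + k * k + k * (2 * length \<pi>)\<close>; once the numbers of
  cells agree, corresponding blocks have equal lengths and can be compared separately.\<close>

lemma cvc_value_eq_iff:
  fixes G H :: "'n::finite set set"
  assumes k: "k \<ge> 1"
  shows "cvc_value k \<sigma>1 \<sigma>2 G \<pi> u = cvc_value k \<sigma>1 \<sigma>2 H \<rho> v \<longleftrightarrow>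
    length \<pi> = length \<rho> \<and> cell_index \<pi> u = cell_index \<rho> v \<and>
    cell_index \<pi> (u \<circ> \<sigma>1) = cell_index \<rho> (v \<circ> \<sigma>1) \<and>
    cell_index \<pi> (u \<circ> \<sigma>2) = cell_index \<rho> (v \<circ> \<sigma>2) \<and>
    comb_matrix k G u = comb_matrix k H v \<and>
    (\<forall>i\<in>{1..k}. \<forall>j<length \<pi>.
      card (tuple_nbrs G i u \<inter> \<pi> ! j) = card (tuple_nbrs H i v \<inter> \<rho> ! j) \<and>
      card (tuple_nonnbrs G i u \<inter> \<pi> ! j) = card (tuple_nonnbrs H i v \<inter> \<rho> ! j))"
proof -
  define N where "N = (\<lambda>(G :: 'n set set) \<pi> u i.
    map (\<lambda>C. int (card (tuple_nbrs G i u \<inter> C))) \<pi> @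
    map (\<lambda>C. int (card (tuple_nonnbrs G i u \<inter> C))) \<pi>)"
  have len: "length (concat (map (N G \<pi> u) [1..<k+1])) = k * (2 * length \<pi>)" for G \<pi> u
    by (simp add: N_def length_concat comp_def sum_list_triv del: upt_Suc)
  have val: "cvc_value k \<sigma>1 \<sigma>2 G \<pi> u =
     [int (cell_index \<pi> u), int (cell_index \<pi> (u \<circ> \<sigma>1)), int (cell_index \<pi> (u \<circ> \<sigma>2))] @
     concat (comb_matrix k G u) @ concat (map (N G \<pi> u) [1..<k+1])" for G \<pi> u
    by (simp only: cvc_value_def N_def)
  have "cvc_value k \<sigma>1 \<sigma>2 G \<pi> u = cvc_value k \<sigma>1 \<sigma>2 H \<rho> v \<Longrightarrow> length \<pi> = length \<rho>"
  proof -
    assume "cvc_value k \<sigma>1 \<sigma>2 G \<pi> u = cvc_value k \<sigma>1 \<sigma>2 H \<rho> v"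
    from arg_cong[OF this, of length] have "k * (2 * length \<pi>) = k * (2 * length \<rho>)"
      unfolding val length_append len length_concat_comb_matrix by simp
    then show ?thesis using k by simp
  qed
  moreover have "cvc_value k \<sigma>1 \<sigma>2 G \<pi> u = cvc_value k \<sigma>1 \<sigma>2 H \<rho> v \<longleftrightarrow>
    cell_index \<pi> u = cell_index \<rho> v \<and>
    cell_index \<pi> (u \<circ> \<sigma>1) = cell_index \<rho> (v \<circ> \<sigma>1) \<and>
    cell_index \<pi> (u \<circ> \<sigma>2) = cell_index \<rho> (v \<circ> \<sigma>2) \<and>
    comb_matrix k G u = comb_matrix k H v \<and>
    (\<forall>i\<in>{1..k}. N G \<pi> u i = N H \<rho> v i)" if l: "length \<pi> = length \<rho>"
  proof -
    have "set [1..<k + 1] = {1..k}" by auto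
    moreover have "length (N G \<pi> u i) = length (N H \<rho> v i)" for i using l by (simp add: N_def)
    ultimately have "concat (map (N G \<pi> u) [1..<k+1]) = concat (map (N H \<rho> v) [1..<k+1]) \<longleftrightarrow>
        (\<forall>i\<in>{1..k}. N G \<pi> u i = N H \<rho> v i)"
      using concat_map_eq_iff[of "[1..<k+1]" "N G \<pi> u" "N H \<rho> v"] by (simp only:)
    then show ?thesis
      unfolding val
      by (simp add: length_concat_comb_matrix concat_comb_matrix_eq_iff del: upt_Suc)
  qed
  moreover have "N G \<pi> u i = N H \<rho> v i \<longleftrightarrow> (\<forall>j<length \<pi>.
      card (tuple_nbrs G i u \<inter> \<pi> ! j) = card (tuple_nbrs H i v \<inter> \<rho> ! j) \<and>
      card (tuple_nonnbrs G i u \<inter> \<pi> ! j) = card (tuple_nonnbrs H i v \<inter> \<rho> ! j))"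
    if l: "length \<pi> = length \<rho>" for i
  proof -
    have "map f \<pi> = map g \<rho> \<longleftrightarrow> (\<forall>j<length \<pi>. f (\<pi> ! j) = g (\<rho> ! j))"
      for f g :: "(nat \<Rightarrow> 'n) set \<Rightarrow> int"
      using l by (auto simp: list_eq_iff_nth_eq)
    then show ?thesis using l by (simp add: N_def) blast
  qed
  ultimately show ?thesis by blast
qed

lemma cvc_value_hd: "hd (cvc_value k \<sigma>1 \<sigma>2 G \<pi> u) = int (cell_index \<pi> u)" "cvc_value k \<sigma>1 \<sigma>2 G \<pi> u \<noteq> []"
  by (simp_all add: cvc_value_def)

lemma cvc_ord_refine_level_sets:
  "cvc_ord_refine k \<sigma>1 \<sigma>2 G \<pi> = level_sets k (cvc_value k \<sigma>1 \<sigma>2 G \<pi>)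
     (sorted_list_of_set (cvc_value k \<sigma>1 \<sigma>2 G \<pi> ` tuples k))"
  by (simp add: cvc_ord_refine_def level_sets_def)

lemma ordered_partition_refine: "ordered_partition k (cvc_ord_refine k \<sigma>1 \<sigma>2 G \<pi>)"
  unfolding cvc_ord_refine_level_sets by (rule ordered_partition_level_sets) simp_all

lemma length_cvc_ord_refine:
  "length (cvc_ord_refine k \<sigma>1 \<sigma>2 G \<pi>) = card (cvc_value k \<sigma>1 \<sigma>2 G \<pi> ` tuples k)"
  by (simp add: cvc_ord_refine_def)

lemma length_ordered_partition:
  fixes \<pi> :: "(nat \<Rightarrow> 'n::finite) set list"
  assumes "ordered_partition k \<pi>"
  shows "length \<pi> \<le> card (tuples k :: (nat \<Rightarrow> 'n) set)"
  using card_image_le[of "tuples k" "cell_index \<pi>"] by (simp add: cell_index_image[OF assms])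

lemma hd_cvc_value_image:
  assumes "ordered_partition k \<pi>"
  shows "hd ` cvc_value k \<sigma>1 \<sigma>2 G \<pi> ` tuples k = int ` {1..length \<pi>}"
  by (simp only: image_image cvc_value_hd flip: cell_index_image[OF assms])

text \<open>The head of a value is the old index, so there are at least as many values as old
  cells.\<close>

lemma length_cvc_ord_refine_ge:
  assumes "ordered_partition k \<pi>"
  shows "length \<pi> \<le> length (cvc_ord_refine k \<sigma>1 \<sigma>2 G \<pi>)"
  using card_image_le[of "cvc_value k \<sigma>1 \<sigma>2 G \<pi> ` tuples k" hd]
  by (simp add: hd_cvc_value_image[OF assms] length_cvc_ord_refine card_image)

text \<open>The old index is the leading entry of the value, so the lexicographic order of the new
  cells refines the old order.\<close>

lemma cvc_ord_refine_eq:
  assumes \<pi>: "ordered_partition k \<pi>" and len: "length (cvc_ord_refine k \<sigma>1 \<sigma>2 G \<pi>) = length \<pi>"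
  shows "cvc_ord_refine k \<sigma>1 \<sigma>2 G \<pi> = \<pi>"
proof -
  let ?D = "cvc_value k \<sigma>1 \<sigma>2 G \<pi>"
  let ?ds = "sorted_list_of_set (?D ` tuples k)"
  have set: "set ?ds = ?D ` tuples k" by simp
  have "card (hd ` ?D ` tuples k) = card (?D ` tuples k)"
    using len by (simp add: hd_cvc_value_image[OF \<pi>] length_cvc_ord_refine card_image)
  \<comment> \<open>With no increase in the number of cells, no cell was split, and the old index
    determines the whole value.\<close>
  then have inj: "inj_on hd (?D ` tuples k)" by (simp add: inj_on_iff_eq_card)
  have "sorted (map hd ?ds)"
  proof -
    have "sorted_wrt (\<lambda>x y. hd x \<le> hd y) ?ds"
    proof (rule sorted_wrt_mono_rel)
      show "sorted_wrt (\<le>) ?ds" by simp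
      fix x y assume xy: "x \<in> set ?ds" "y \<in> set ?ds" "x \<le> y"
      then obtain a x' b y' where "x = a # x'" "y = b # y'"
        using cvc_value_hd(2) unfolding set by (metis imageE neq_Nil_conv)
      then show "hd x \<le> hd y" using xy(3) by auto
    qed
    then show ?thesis by (simp add: sorted_map)
  qed
  moreover have "distinct (map hd ?ds)" using inj by (simp add: distinct_map)
  moreover have "set (map hd ?ds) = int ` {1..length \<pi>}"
    using hd_cvc_value_image[OF \<pi>] by (simp add: set del: set_sorted_list_of_set)
  moreover have "sorted (map int [1..<Suc (length \<pi>)])" "distinct (map int [1..<Suc (length \<pi>)])"
    by (simp_all add: sorted_map distinct_map inj_on_def del: upt_Suc)
  moreover have "set (map int [1..<Suc (length \<pi>)]) = int ` {1..length \<pi>}"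
    by (simp add: atLeastLessThanSuc_atLeastAtMost del: upt_Suc)
  \<comment> \<open>The heads form a sorted list without repetition and with the old indices as
    elements, so position \<open>i\<close> carries the old index \<open>Suc i\<close>.\<close>
  ultimately have hd_ds: "map hd ?ds = map int [1..<Suc (length \<pi>)]"
    by (metis sorted_distinct_set_unique)
  show ?thesis
  proof (rule nth_equalityI[OF len])
    fix i assume "i < length (cvc_ord_refine k \<sigma>1 \<sigma>2 G \<pi>)"
    then have i: "i < length \<pi>" "i < length ?ds" using len by (simp_all add: cvc_ord_refine_def)
    have h: "hd (?ds ! i) = int (Suc i)"
      using arg_cong[OF hd_ds, of "\<lambda>l. l ! i"] i by (simp del: upt_Suc)
    have "?ds ! i \<in> ?D ` tuples k" using nth_mem[OF i(2)] unfolding set .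
    then have "?D u = ?ds ! i \<longleftrightarrow> cell_index \<pi> u = Suc i" if "u \<in> tuples k" for u
      using inj_onD[OF inj, of "?D u" "?ds ! i"] h that cvc_value_hd(1)[of k \<sigma>1 \<sigma>2 G \<pi> u] by auto
    then have "{u \<in> tuples k. ?D u = ?ds ! i} = color_class k (cell_index \<pi>) (Suc i)"
      by (auto simp: color_class_def)
    then show "cvc_ord_refine k \<sigma>1 \<sigma>2 G \<pi> ! i = \<pi> ! i"
      using i by (simp add: cvc_ord_refine_def color_class_cell_index[OF \<pi>])
  qed
qed

section \<open>Running the ordered refinement on two graphs\<close>

definition ord_seq ::
    "nat \<Rightarrow> (nat \<Rightarrow> nat) \<Rightarrow> (nat \<Rightarrow> nat) \<Rightarrow> 'n::finite set set \<Rightarrow> nat \<Rightarrow> (nat \<Rightarrow> 'n) set list" where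
  "ord_seq k \<sigma>1 \<sigma>2 G t = (cvc_ord_refine k \<sigma>1 \<sigma>2 G ^^ t) [tuples k]"

lemma ord_seq_simps:
  "ord_seq k \<sigma>1 \<sigma>2 G 0 = [tuples k]"
  "ord_seq k \<sigma>1 \<sigma>2 G (Suc t) = cvc_ord_refine k \<sigma>1 \<sigma>2 G (ord_seq k \<sigma>1 \<sigma>2 G t)"
  by (simp_all add: ord_seq_def)

lemma ordered_partition_ord_seq:
  fixes G :: "'n::finite set set"
  shows "ordered_partition k (ord_seq k \<sigma>1 \<sigma>2 G t)"
proof (cases t)
  case 0
  have "(tuples k :: (nat \<Rightarrow> 'n) set) \<noteq> {}" using diag_tuple_mem by blast
  then show ?thesis
    unfolding 0 ord_seq_simps ordered_partition_def by (auto intro!: ex1I[of _ 0])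
qed (simp add: ord_seq_simps ordered_partition_refine)

text \<open>The number of cells never decreases and is bounded by the number of tuples; two
  consecutive rounds with equally many cells are already equal as ordered partitions.\<close>

lemma cvc_ord_stable_iterate:
  fixes G :: "'n::finite set set"
  obtains s where "cvc_ord_refine k \<sigma>1 \<sigma>2 G (cvc_ord_stable k \<sigma>1 \<sigma>2 G) = cvc_ord_stable k \<sigma>1 \<sigma>2 G"
    "\<And>t. s \<le> t \<Longrightarrow> ord_seq k \<sigma>1 \<sigma>2 G t = cvc_ord_stable k \<sigma>1 \<sigma>2 G"
proof -
  let ?l = "\<lambda>t. length (ord_seq k \<sigma>1 \<sigma>2 G t)"
  let ?N = "card (tuples k :: (nat \<Rightarrow> 'n) set)"
  have le: "?l t \<le> ?l (Suc t)" for t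
    unfolding ord_seq_simps by (rule length_cvc_ord_refine_ge[OF ordered_partition_ord_seq])
  have "?N - ?l (Suc t) \<le> ?N - ?l t" for t using le[of t] by linarith
  then obtain t where "?N - ?l (Suc t) = ?N - ?l t"
    using nat_decreasing_stationary[of "\<lambda>t. ?N - ?l t"] by blast
  moreover have "?l (Suc t) \<le> ?N" "?l t \<le> ?N"
    by (rule length_ordered_partition[OF ordered_partition_ord_seq])+
  ultimately have "?l (Suc t) = ?l t" by linarith
  then have "ord_seq k \<sigma>1 \<sigma>2 G (Suc t) = ord_seq k \<sigma>1 \<sigma>2 G t"
    unfolding ord_seq_simps by (rule cvc_ord_refine_eq[OF ordered_partition_ord_seq])
  then have "(cvc_ord_refine k \<sigma>1 \<sigma>2 G ^^ Suc t) [tuples k] = (cvc_ord_refine k \<sigma>1 \<sigma>2 G ^^ t) [tuples k]"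
    by (simp only: ord_seq_def)
  then show ?thesis
    by (rule iterate_until_stable) (rule that; simp only: ord_seq_def cvc_ord_stable_def)
qed

lemma relaxed_iso_cvc_value:
  assumes k: "k \<ge> 1" and gen: "generates_sym k \<sigma>1 \<sigma>2" and Y: "relaxed_iso k G H Y"
    and \<pi>: "ordered_partition k \<pi>" and \<rho>: "ordered_partition k \<rho>" and len: "length \<pi> = length \<rho>"
    and supp: "\<And>u v. u \<in> tuples k \<Longrightarrow> v \<in> tuples k \<Longrightarrow> 0 < Y (tuple_pairs k u v) \<Longrightarrow>
      cell_index \<pi> u = cell_index \<rho> v"
    and uv: "u \<in> tuples k" "v \<in> tuples k" "0 < Y (tuple_pairs k u v)"
  shows "cvc_value k \<sigma>1 \<sigma>2 G \<pi> u = cvc_value k \<sigma>1 \<sigma>2 H \<rho> v"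
proof -
  have perm: "cell_index \<pi> (u \<circ> \<sigma>) = cell_index \<rho> (v \<circ> \<sigma>)" if "\<sigma> permutes {1..k}" for \<sigma>
  proof (rule supp)
    show "0 < Y (tuple_pairs k (u \<circ> \<sigma>) (v \<circ> \<sigma>))"
      unfolding tuple_pairs_permute[OF that] by (rule uv(3))
  qed (rule tuple_permute[OF _ that], rule uv)+
  have deg: "card (tuple_nbrs G i u \<inter> \<pi> ! j) = card (tuple_nbrs H i v \<inter> \<rho> ! j)"
    "card (tuple_nonnbrs G i u \<inter> \<pi> ! j) = card (tuple_nonnbrs H i v \<inter> \<rho> ! j)"
    if i: "i \<in> {1..k}" and j: "j < length \<pi>" for i j
  proof -
    have jr: "j < length \<rho>" using j len by simp
    note d = relaxed_iso_degree[OF Y, where cG = "cell_index \<pi>" and cH = "cell_index \<rho>" and d = "Suc j",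
        OF supp i uv, unfolded color_class_cell_index[OF \<pi> j] color_class_cell_index[OF \<rho> jr]]
    show "card (tuple_nbrs G i u \<inter> \<pi> ! j) = card (tuple_nbrs H i v \<inter> \<rho> ! j)"
      "card (tuple_nonnbrs G i u \<inter> \<pi> ! j) = card (tuple_nonnbrs H i v \<inter> \<rho> ! j)"
      by (rule d; assumption)+
  qed
  have "\<sigma>1 permutes {1..k}" "\<sigma>2 permutes {1..k}" using gen by (auto simp: generates_sym_def)
  then show ?thesis
    unfolding cvc_value_eq_iff[OF k]
    by (intro conjI ballI allI impI len supp[OF uv] perm relaxed_iso_comb_matrix[OF Y uv(3)] deg)
qed

lemma card_color_class_image_eq:
  fixes D D' :: "(nat \<Rightarrow> 'n::finite) \<Rightarrow> 'd"
  assumes "\<And>d. card (color_class k D d) = card (color_class k D' d)"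
  shows "D ` tuples k = D' ` tuples k"
proof -
  have mem: "d \<in> D ` tuples k \<longleftrightarrow> card (color_class k D d) \<noteq> 0" for d and D :: "(nat \<Rightarrow> 'n) \<Rightarrow> 'd"
    by (auto simp: color_class_def)
  show ?thesis by (rule Set.set_eqI) (simp only: mem assms)
qed

text \<open>Values agree along the support, so corresponding classes have equal size and both graphs
  attain the same values. The two sorted lists then coincide, and equal values receive equal indices
  in the next round.\<close>

lemma relaxed_iso_ord_seq:
  assumes k: "k \<ge> 1" and gen: "generates_sym k \<sigma>1 \<sigma>2" and Y: "relaxed_iso k G H Y"
  shows "length (ord_seq k \<sigma>1 \<sigma>2 G t) = length (ord_seq k \<sigma>1 \<sigma>2 H t) \<and>
    (\<forall>u\<in>tuples k. \<forall>v\<in>tuples k. 0 < Y (tuple_pairs k u v) \<longrightarrow>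
      cell_index (ord_seq k \<sigma>1 \<sigma>2 G t) u = cell_index (ord_seq k \<sigma>1 \<sigma>2 H t) v)"
proof (induction t)
  case 0
  have "cell_index [tuples k] u = Suc 0" if "u \<in> tuples k" for u :: "nat \<Rightarrow> 'a"
    using cell_index_unique[OF ordered_partition_ord_seq[of k \<sigma>1 \<sigma>2 G 0], of 0 u] that
    by (simp add: ord_seq_simps)
  then show ?case by (simp add: ord_seq_simps)
next
  case (Suc t)
  let ?D = "cvc_value k \<sigma>1 \<sigma>2 G (ord_seq k \<sigma>1 \<sigma>2 G t)" and ?D' = "cvc_value k \<sigma>1 \<sigma>2 H (ord_seq k \<sigma>1 \<sigma>2 H t)"
  have val: "?D u = ?D' v" if "u \<in> tuples k" "v \<in> tuples k" "0 < Y (tuple_pairs k u v)" for u v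
  proof (rule relaxed_iso_cvc_value[OF k gen Y ordered_partition_ord_seq ordered_partition_ord_seq _ _ that])
    show "length (ord_seq k \<sigma>1 \<sigma>2 G t) = length (ord_seq k \<sigma>1 \<sigma>2 H t)" using Suc by (rule conjunct1)
  qed (use Suc in blast)
  have img: "?D ` tuples k = ?D' ` tuples k"
    by (rule card_color_class_image_eq, rule relaxed_iso_class_card[OF Y val])
  show ?case
    unfolding ord_seq_simps cvc_ord_refine_level_sets
  proof (intro conjI ballI impI)
    show "length (level_sets k ?D (sorted_list_of_set (?D ` tuples k))) =
        length (level_sets k ?D' (sorted_list_of_set (?D' ` tuples k)))"
      unfolding img by (simp add: level_sets_def)
    fix u v assume uv: "u \<in> tuples k" "v \<in> tuples k" "0 < Y (tuple_pairs k u v)"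
    have ds: "distinct (sorted_list_of_set (?D' ` tuples k))"
      "set (sorted_list_of_set (?D' ` tuples k)) = ?D' ` tuples k" by simp_all
    show "cell_index (level_sets k ?D (sorted_list_of_set (?D ` tuples k))) u =
        cell_index (level_sets k ?D' (sorted_list_of_set (?D' ` tuples k))) v"
      unfolding img cell_index_level_sets_eq_iff[OF ds(1) ds(2)[THEN trans, OF img[symmetric]] ds(2) uv(1,2)]
      by (rule val[OF uv])
  qed
qed

text \<open>Bijections between equally large classes are glued along the colours.\<close>

lemma ex_color_preserving_bij:
  fixes D D' :: "(nat \<Rightarrow> 'n::finite) \<Rightarrow> 'd"
  assumes card: "\<And>d. card (color_class k D d) = card (color_class k D' d)"
  obtains \<gamma> where "bij_betw \<gamma> (tuples k) (tuples k)" "\<And>u. u \<in> tuples k \<Longrightarrow> D u = D' (\<gamma> u)"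
proof -
  have "\<exists>h. bij_betw h (color_class k D d) (color_class k D' d)" for d
    by (rule finite_same_card_bij[OF _ _ card]) simp_all
  then obtain h where h: "\<And>d. bij_betw (h d) (color_class k D d) (color_class k D' d)" by metis
  define \<gamma> where "\<gamma> u = h (D u) u" for u
  have mem: "\<gamma> u \<in> color_class k D' (D u)" if "u \<in> tuples k" for u
    using bij_betwE[OF h[of "D u"]] that by (simp add: \<gamma>_def color_class_def)
  have D: "D u = D' (\<gamma> u)" if "u \<in> tuples k" for u
    using mem[OF that] by (simp add: color_class_def)
  have "inj_on \<gamma> (tuples k)"
  proof (rule inj_onI)
    fix x y assume xy: "x \<in> tuples k" "y \<in> tuples k" "\<gamma> x = \<gamma> y"
    then have "D x = D y" using D by metis
    then show "x = y"
      using xy bij_betw_imp_inj_on[OF h[of "D x"]] by (simp add: \<gamma>_def inj_on_def color_class_def)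
  qed
  moreover have "\<gamma> ` tuples k \<subseteq> tuples k" using mem by (auto simp: color_class_def)
  ultimately have "bij_betw \<gamma> (tuples k) (tuples k)" by (simp add: bij_betw_def endo_inj_surj)
  then show ?thesis using D by (rule that)
qed

text \<open>The hypothesis compares \<open>u\<close> only with \<open>\<gamma> u\<close>. For any
  other \<open>v\<close> of the same index, stability of \<open>\<rho>\<close> gives
  \<open>v\<close> and \<open>\<gamma> u\<close> the same value.\<close>

lemma stable_pair_cell_index:
  assumes k: "k \<ge> 1" and gen: "generates_sym k \<sigma>1 \<sigma>2"
    and \<gamma>: "bij_betw \<gamma> (tuples k) (tuples k)"
    and val: "\<And>u. u \<in> tuples k \<Longrightarrow> cvc_value k \<sigma>1 \<sigma>2 G \<pi> u = cvc_value k \<sigma>1 \<sigma>2 H \<rho> (\<gamma> u)"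
    and \<pi>: "ordered_partition k \<pi>" and \<rho>: "ordered_partition k \<rho>"
    and stable: "cvc_ord_refine k \<sigma>1 \<sigma>2 H \<rho> = \<rho>"
  shows "stable_pair k G H (cell_index \<pi>) (cell_index \<rho>)"
proof -
  have index: "cell_index \<pi> u = cell_index \<rho> (\<gamma> u)" if "u \<in> tuples k" for u
    using val[OF that] unfolding cvc_value_eq_iff[OF k] by blast
  have \<gamma>T: "\<gamma> u \<in> tuples k" if "u \<in> tuples k" for u using bij_betwE[OF \<gamma>] that by blast
  have same: "cvc_value k \<sigma>1 \<sigma>2 G \<pi> u = cvc_value k \<sigma>1 \<sigma>2 H \<rho> v"
    if uv: "u \<in> tuples k" "v \<in> tuples k" "cell_index \<pi> u = cell_index \<rho> v" for u v
  proof -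
    let ?D = "cvc_value k \<sigma>1 \<sigma>2 H \<rho>"
    have "cell_index (cvc_ord_refine k \<sigma>1 \<sigma>2 H \<rho>) (\<gamma> u) = cell_index (cvc_ord_refine k \<sigma>1 \<sigma>2 H \<rho>) v"
      unfolding stable using index[OF uv(1)] uv(3) by simp
    then have "?D (\<gamma> u) = ?D v"
      unfolding cvc_ord_refine_level_sets
      by (subst (asm) cell_index_level_sets_eq_iff) (simp_all add: uv \<gamma>T)
    then show ?thesis using val[OF uv(1)] by simp
  qed
  note same_iff = same[unfolded cvc_value_eq_iff[OF k]]
  have len: "length \<pi> = length \<rho>"
    using val[OF diag_tuple_mem] unfolding cvc_value_eq_iff[OF k] by blast
  show ?thesis
  proof
    fix u v :: "nat \<Rightarrow> 'a" assume uv: "u \<in> tuples k" "v \<in> tuples k" "cell_index \<pi> u = cell_index \<rho> v"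
    show "cell_index \<pi> (u \<circ> \<tau>) = cell_index \<rho> (v \<circ> \<tau>)" if \<tau>: "\<tau> permutes {1..k}" for \<tau>
      by (rule generates_sym_closed[where R = "\<lambda>u v. cell_index \<pi> u = cell_index \<rho> v", OF gen _ _ \<tau> uv])
        (use same_iff in blast)+
    show "comb_entry G u i j = comb_entry H v i j" if "i \<in> {1..k}" "j \<in> {1..k}" for i j
      using same_iff[OF uv] that unfolding comb_matrix_eq_iff by blast
    have "card (tuple_nbrs G i u \<inter> color_class k (cell_index \<pi>) d) =
          card (tuple_nbrs H i v \<inter> color_class k (cell_index \<rho>) d) \<and>
        card (tuple_nonnbrs G i u \<inter> color_class k (cell_index \<pi>) d) =
          card (tuple_nonnbrs H i v \<inter> color_class k (cell_index \<rho>) d)"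
      if i: "i \<in> {1..k}" for i d
    proof (cases "d \<in> {1..length \<pi>}")
      case True
      then obtain j where j: "d = Suc j" "j < length \<pi>" by (cases d) auto
      then show ?thesis
        using same_iff[OF uv] i
        by (simp add: color_class_cell_index[OF \<pi>] color_class_cell_index[OF \<rho>] len)
    next
      case False
      then have "color_class k (cell_index \<pi>) d = {}" "color_class k (cell_index \<rho>) d = {}"
        using cell_index_image[OF \<pi>] cell_index_image[OF \<rho>] unfolding len color_class_def by blast+
      then show ?thesis by simp
    qed
    then show "card (tuple_nbrs G i u \<inter> color_class k (cell_index \<pi>) d) =
          card (tuple_nbrs H i v \<inter> color_class k (cell_index \<rho>) d)"
      "card (tuple_nonnbrs G i u \<inter> color_class k (cell_index \<pi>) d) =
          card (tuple_nonnbrs H i v \<inter> color_class k (cell_index \<rho>) d)" if "i \<in> {1..k}" for i d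
      using that by blast+
  next
    fix d
    have "bij_betw \<gamma> (color_class k (cell_index \<pi>) d) (color_class k (cell_index \<rho>) d)"
    proof (rule bij_betw_subset[OF \<gamma>])
      show "color_class k (cell_index \<pi>) d \<subseteq> tuples k" by (auto simp: color_class_def)
      show "\<gamma> ` color_class k (cell_index \<pi>) d = color_class k (cell_index \<rho>) d"
      proof (intro equalityI subsetI)
        fix v assume v: "v \<in> color_class k (cell_index \<rho>) d"
        then obtain u where "u \<in> tuples k" "v = \<gamma> u"
          using bij_betw_imp_surj_on[OF \<gamma>] unfolding color_class_def by blast
        then show "v \<in> \<gamma> ` color_class k (cell_index \<pi>) d"
          using v index by (auto simp: color_class_def)
      qed (use index \<gamma>T in \<open>auto simp: color_class_def\<close>)
    qed
    then show "card (color_class k (cell_index \<pi>) d) = card (color_class k (cell_index \<rho>) d)"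
      by (rule bij_betw_same_card)
  qed (rule k)
qed

lemma relaxation_empty_iff:
  fixes G H :: "'n::finite set set"
  assumes k: "k \<ge> 1" and gen: "generates_sym k \<sigma>1 \<sigma>2"
  shows "iso_relaxation k G H = {} \<longleftrightarrow> cvc_determines_nonisomorphic k \<sigma>1 \<sigma>2 G H"
proof -
  let ?\<pi> = "cvc_ord_stable k \<sigma>1 \<sigma>2 G" and ?\<rho> = "cvc_ord_stable k \<sigma>1 \<sigma>2 H"
  let ?iso = "\<lambda>\<gamma>. bij_betw \<gamma> (tuples k) (tuples k) \<and>
    (\<forall>u\<in>tuples k. cvc_value k \<sigma>1 \<sigma>2 G ?\<pi> u = cvc_value k \<sigma>1 \<sigma>2 H ?\<rho> (\<gamma> u))"
  obtain s where s: "\<And>t. s \<le> t \<Longrightarrow> ord_seq k \<sigma>1 \<sigma>2 G t = ?\<pi>"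
    using cvc_ord_stable_iterate[of k \<sigma>1 \<sigma>2 G] by blast
  obtain s' where stable: "cvc_ord_refine k \<sigma>1 \<sigma>2 H ?\<rho> = ?\<rho>"
    and s': "\<And>t. s' \<le> t \<Longrightarrow> ord_seq k \<sigma>1 \<sigma>2 H t = ?\<rho>"
    using cvc_ord_stable_iterate[of k \<sigma>1 \<sigma>2 H] by blast
  \<comment> \<open>The two graphs may stabilize in different rounds; at the later one both
    sequences have reached their limits.\<close>
  have seq: "ord_seq k \<sigma>1 \<sigma>2 G (max s s') = ?\<pi>" "ord_seq k \<sigma>1 \<sigma>2 H (max s s') = ?\<rho>"
    using s s' by simp_all
  have \<pi>: "ordered_partition k ?\<pi>" and \<rho>: "ordered_partition k ?\<rho>"
    unfolding seq[symmetric] by (rule ordered_partition_ord_seq)+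
  have "\<exists>\<gamma>. ?iso \<gamma>" if Y: "relaxed_iso k G H Y" for Y
  proof -
    note ind = relaxed_iso_ord_seq[OF k gen Y, of "max s s'", unfolded seq]
    have val: "cvc_value k \<sigma>1 \<sigma>2 G ?\<pi> u = cvc_value k \<sigma>1 \<sigma>2 H ?\<rho> v"
      if "u \<in> tuples k" "v \<in> tuples k" "0 < Y (tuple_pairs k u v)" for u v
      by (rule relaxed_iso_cvc_value[OF k gen Y \<pi> \<rho> conjunct1[OF ind] _ that]) (use ind in blast)
    have "card (color_class k (cvc_value k \<sigma>1 \<sigma>2 G ?\<pi>) d) = card (color_class k (cvc_value k \<sigma>1 \<sigma>2 H ?\<rho>) d)" for d
      by (rule relaxed_iso_class_card[OF Y val])
    then show ?thesis by (rule ex_color_preserving_bij) blast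
  qed
  moreover have "\<exists>Y. relaxed_iso k G H Y" if "?iso \<gamma>" for \<gamma>
  proof -
    have "stable_pair k G H (cell_index ?\<pi>) (cell_index ?\<rho>)"
      by (rule stable_pair_cell_index[OF k gen _ _ \<pi> \<rho> stable]) (use that in blast)+
    from stable_pair.ex_relaxed_iso[OF this] show ?thesis by blast
  qed
  moreover have "iso_relaxation k G H \<noteq> {} \<longleftrightarrow> (\<exists>Y. relaxed_iso k G H Y)"
  proof
    assume "\<exists>Y. relaxed_iso k G H Y"
    then obtain Y where "relaxed_iso k G H Y" ..
    then have "(\<chi> a b. Y {(a, b)}) \<in> iso_relaxation k G H" unfolding iso_relaxation_iff by auto
    then show "iso_relaxation k G H \<noteq> {}" by blast
  next
    assume "iso_relaxation k G H \<noteq> {}"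
    then obtain X where "X \<in> iso_relaxation k G H" by blast
    then show "\<exists>Y. relaxed_iso k G H Y" unfolding iso_relaxation_iff by blast
  qed
  ultimately show ?thesis unfolding cvc_determines_nonisomorphic_def by blast
qed

theorem theorem1p1:
  fixes G H :: "'n::finite set set" and k :: nat and \<sigma>1 \<sigma>2 :: "nat \<Rightarrow> nat"
  assumes "k \<ge> 1"
    and "simple_graph G" and "simple_graph H"
    and "generates_sym k \<sigma>1 \<sigma>2"
  shows "(iso_relaxation k G G = {mat 1} \<longleftrightarrow> cvc_determines_asymmetric k \<sigma>1 \<sigma>2 G) \<and>
         (iso_relaxation k G H = {} \<longleftrightarrow> cvc_determines_nonisomorphic k \<sigma>1 \<sigma>2 G H)"
  by (intro conjI relaxation_identity_iff[OF assms(1,4)] relaxation_empty_iff[OF assms(1,4)])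

end
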